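(* Let $G$ be a connected finite simple graph with vertices $u_1,\dots,u_{\nu_G}$, and let $F$ be a Schreier graph on vertices $v_1,\dots,v_{\nu_F}$ with connecting set $S\subseteq S_{\nu_F}$. Let $\phi:E(\vec G)\to \mathrm{Aut}(F)$ be a voltage assignment, and let $\Gamma$ be the subgroup of $S_{\nu_F}$ generated by $\{\phi(e): e\in E(\vec G)\}\cup S$. Let $\rho_1=1,\rho_2,\dots,\rho_\ell$ be a complete set of pairwise inequivalent irreducible complex (unitary) matrix representations of $\Gamma$, of degrees $f_1,\dots,f_\ell$, and let $m_i\ge 0$ be the multiplicity of $\rho_i$ in the permutation representation $P$ of $\Gamma$ (so $\sum_{i=1}^\ell m_if_i=\nu_F$). Then for every $\mu\in\mathbb{C}$ the matrix $A(G\times^\phi F)-\mu\mathcal{D}(G\times^\phi F)$ is similar to $$\bigoplus_{i=1}^{\ell} I_{m_i}\otimes\Bigl(\sum_{\gamma\in\Gamma}\rho_i(\gamma)\otimes A(\vec G_{(\phi,\gamma)})-I_{f_i}\otimes \mu\bigl(\mathcal{D}(G)+|S|I_{\nu_G}\bigr)+\Bigl(\sum_{s\in S}\rho_i(s)\Bigr)\otimes I_{\nu_G}\Bigr).$$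
   Context: For a graph $X$, $A(X)$ denotes its adjacency matrix, $\mathcal{D}(X)$ its diagonal degree matrix, $\nu_X$ its number of vertices. $\vec G$ is the digraph obtained from $G$ by replacing each edge by a pair of oppositely directed edges; $e^{-1}$ is the reverse of $e$. A voltage assignment $\phi:E(\vec G)\to \mathrm{Aut}(F)$ is a function with $\phi(e^{-1})=\phi(e)^{-1}$. The graph bundle $G\times^\phi F$ has vertex set $V(G)\times V(F)$, with $(u_1,v_1)$ adjacent to $(u_2,v_2)$ iff either $u_1u_2\in E(\vec G)$ and $v_2=\phi(u_1u_2)(v_1)$, or $u_1=u_2$ and $v_1v_2\in E(F)$. For $\gamma$ a permutation of $V(F)$, $P(\gamma)$ is the $\nu_F\times\nu_F$ matrix with $(i,j)$-entry $1$ if $\gamma(v_i)=v_j$ and $0$ otherwise; permutations are composed so that $P(\delta\gamma)=P(\delta)P(\gamma)$ (i.e. $\delta\gamma$ applies $\delta$ first), making $P$ a representation of $\Gamma$, called the permutation representation. $A(\vec G_{(\phi,\gamma)})$ is the $\nu_G\times\nu_G$ matrix whose $(a,b)$-entry is $1$ if $u_au_b\in E(\vec G)$ and $\phi(u_au_b)=\gamma$, and $0$ otherwise. A Schreier graph with connecting set $S$ is a simple graph $F$ for which $S\subseteq S_{\nu_F}$, $S^{-1}=S$, and $A(F)=\sum_{s\in S}P(s)$; it is regular of degree $|S|$. $\otimes$ is the Kronecker product and $I_k$ the $k\times k$ identity matrix. *)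

theory Defs
  imports
    "Jordan_Normal_Form.Schur_Decomposition"
    "Jordan_Normal_Form.VS_Connect"
    "HOL-Algebra.Generated_Groups"
    "HOL-Combinatorics.Permutations"
    "Graph_Theory.Pair_Digraph"
    "Graph_Theory.Digraph_Component"
begin

text \<open>
  A finite simple graph is a \<open>pair_graph\<close>: a finite, loop-free, symmetric set of arcs. Such a
  structure is at once the graph \<open>G\<close> and the digraph obtained from it by replacing each edge by two
  opposite arcs, and the reverse of the arc \<open>(u, v)\<close> is \<open>(v, u)\<close>.
  Matrices indexed by vertices refer to an enumeration of the vertex set, given as a list.
\<close>

definition adjacency_mat :: "'a list \<Rightarrow> 'a pair_pre_digraph \<Rightarrow> complex mat" where
  "adjacency_mat xs X = mat (length xs) (length xs)
     (\<lambda>(i, j). if (xs ! i, xs ! j) \<in> parcs X then 1 else 0)"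

definition deg_mat :: "'a list \<Rightarrow> 'a pair_pre_digraph \<Rightarrow> complex mat" where
  "deg_mat xs X = mat (length xs) (length xs)
     (\<lambda>(i, j). if i = j then of_nat (out_degree (with_proj X) (xs ! i)) else 0)"

definition kronecker :: "complex mat \<Rightarrow> complex mat \<Rightarrow> complex mat" where
  "kronecker A B = mat (dim_row A * dim_row B) (dim_col A * dim_col B)
     (\<lambda>(i, j). A $$ (i div dim_row B, j div dim_col B) * B $$ (i mod dim_row B, j mod dim_col B))"

abbreviation mat_sum :: "nat \<Rightarrow> ('i \<Rightarrow> complex mat) \<Rightarrow> 'i set \<Rightarrow> complex mat" where
  "mat_sum n M I \<equiv> finsum (module_mat TYPE(complex) n n) M I"

text \<open>
  The symmetric group on \<open>V\<close>. A product applies its left factor first, so that \<open>perm_mat\<close> below is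
  multiplicative. Permutations are functions that are the identity outside \<open>V\<close>.
\<close>

definition perm_group :: "'b set \<Rightarrow> ('b \<Rightarrow> 'b) monoid" where
  "perm_group V = \<lparr>carrier = {p. p permutes V}, monoid.mult = (\<lambda>\<delta> \<gamma>. \<gamma> \<circ> \<delta>), one = id\<rparr>"

definition perm_mat :: "'b list \<Rightarrow> ('b \<Rightarrow> 'b) \<Rightarrow> complex mat" where
  "perm_mat vs \<gamma> = mat (length vs) (length vs) (\<lambda>(i, j). if \<gamma> (vs ! i) = vs ! j then 1 else 0)"

definition graph_Aut :: "'b pair_pre_digraph \<Rightarrow> ('b \<Rightarrow> 'b) set" where
  "graph_Aut F = {\<gamma>. \<gamma> permutes pverts F \<and>
     (\<forall>v\<in>pverts F. \<forall>w\<in>pverts F. (\<gamma> v, \<gamma> w) \<in> parcs F \<longleftrightarrow> (v, w) \<in> parcs F)}"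

definition voltage_assignment ::
    "'a pair_pre_digraph \<Rightarrow> 'b pair_pre_digraph \<Rightarrow> ('a \<times> 'a \<Rightarrow> 'b \<Rightarrow> 'b) \<Rightarrow> bool" where
  "voltage_assignment G F \<phi> \<longleftrightarrow>
     (\<forall>e\<in>parcs G. \<phi> e \<in> graph_Aut F) \<and>
     (\<forall>(u, v)\<in>parcs G. \<phi> (v, u) = inv\<^bsub>perm_group (pverts F)\<^esub> (\<phi> (u, v)))"

definition graph_bundle ::
    "'a pair_pre_digraph \<Rightarrow> ('a \<times> 'a \<Rightarrow> 'b \<Rightarrow> 'b) \<Rightarrow> 'b pair_pre_digraph \<Rightarrow> ('a \<times> 'b) pair_pre_digraph" where
  "graph_bundle G \<phi> F = \<lparr>pverts = pverts G \<times> pverts F,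
     parcs = {((u\<^sub>1, v\<^sub>1), (u\<^sub>2, v\<^sub>2)) | u\<^sub>1 v\<^sub>1 u\<^sub>2 v\<^sub>2.
       (u\<^sub>1, v\<^sub>1) \<in> pverts G \<times> pverts F \<and> (u\<^sub>2, v\<^sub>2) \<in> pverts G \<times> pverts F \<and>
       ((u\<^sub>1, u\<^sub>2) \<in> parcs G \<and> v\<^sub>2 = \<phi> (u\<^sub>1, u\<^sub>2) v\<^sub>1 \<or> u\<^sub>1 = u\<^sub>2 \<and> (v\<^sub>1, v\<^sub>2) \<in> parcs F)}\<rparr>"

definition voltage_adj_mat ::
    "'a list \<Rightarrow> 'a pair_pre_digraph \<Rightarrow> ('a \<times> 'a \<Rightarrow> 'b \<Rightarrow> 'b) \<Rightarrow> ('b \<Rightarrow> 'b) \<Rightarrow> complex mat" where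
  "voltage_adj_mat us G \<phi> \<gamma> = mat (length us) (length us)
     (\<lambda>(a, b). if (us ! a, us ! b) \<in> parcs G \<and> \<phi> (us ! a, us ! b) = \<gamma> then 1 else 0)"

definition schreier_graph :: "'b list \<Rightarrow> ('b \<Rightarrow> 'b) set \<Rightarrow> 'b pair_pre_digraph \<Rightarrow> bool" where
  "schreier_graph vs S F \<longleftrightarrow>
     pair_graph F \<and> distinct vs \<and> set vs = pverts F \<and>
     S \<subseteq> carrier (perm_group (pverts F)) \<and>
     (\<lambda>s. inv\<^bsub>perm_group (pverts F)\<^esub> s) ` S = S \<and>
     adjacency_mat vs F = mat_sum (length vs) (perm_mat vs) S"

definition matrix_rep :: "('g, 'c) monoid_scheme \<Rightarrow> nat \<Rightarrow> ('g \<Rightarrow> complex mat) \<Rightarrow> bool" where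
  "matrix_rep \<Gamma> n \<rho> \<longleftrightarrow>
     (\<forall>g\<in>carrier \<Gamma>. \<rho> g \<in> carrier_mat n n) \<and> \<rho> \<one>\<^bsub>\<Gamma>\<^esub> = 1\<^sub>m n \<and>
     (\<forall>g\<in>carrier \<Gamma>. \<forall>h\<in>carrier \<Gamma>. \<rho> (g \<otimes>\<^bsub>\<Gamma>\<^esub> h) = \<rho> g * \<rho> h)"

definition unitary_rep :: "('g, 'c) monoid_scheme \<Rightarrow> nat \<Rightarrow> ('g \<Rightarrow> complex mat) \<Rightarrow> bool" where
  "unitary_rep \<Gamma> n \<rho> \<longleftrightarrow>
     matrix_rep \<Gamma> n \<rho> \<and> (\<forall>g\<in>carrier \<Gamma>. \<rho> g * mat_adjoint (\<rho> g) = 1\<^sub>m n)"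

definition irreducible_rep :: "('g, 'c) monoid_scheme \<Rightarrow> nat \<Rightarrow> ('g \<Rightarrow> complex mat) \<Rightarrow> bool" where
  "irreducible_rep \<Gamma> n \<rho> \<longleftrightarrow>
     matrix_rep \<Gamma> n \<rho> \<and> 0 < n \<and>
     (\<forall>W. VectorSpace.subspace class_ring W (module_vec TYPE(complex) n) \<and>
          (\<forall>g\<in>carrier \<Gamma>. \<forall>w\<in>W. \<rho> g *\<^sub>v w \<in> W) \<longrightarrow>
          W = {0\<^sub>v n} \<or> W = carrier_vec n)"

text \<open>One pair of mutually inverse matrices conjugates \<open>\<sigma> g\<close> to \<open>\<rho> g\<close> for all \<open>g\<close> simultaneously.\<close>

definition rep_equiv ::
    "('g, 'c) monoid_scheme \<Rightarrow> ('g \<Rightarrow> complex mat) \<Rightarrow> ('g \<Rightarrow> complex mat) \<Rightarrow> bool" where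
  "rep_equiv \<Gamma> \<rho> \<sigma> \<longleftrightarrow> (\<exists>T T'. \<forall>g\<in>carrier \<Gamma>. similar_mat_wit (\<rho> g) (\<sigma> g) T T')"

definition complete_irreps ::
    "('g, 'c) monoid_scheme \<Rightarrow> nat \<Rightarrow> (nat \<Rightarrow> nat) \<Rightarrow> (nat \<Rightarrow> 'g \<Rightarrow> complex mat) \<Rightarrow> bool" where
  "complete_irreps \<Gamma> l f \<rho> \<longleftrightarrow>
     (\<forall>i\<in>{1..l}. irreducible_rep \<Gamma> (f i) (\<rho> i)) \<and>
     (\<forall>i\<in>{1..l}. \<forall>j\<in>{1..l}. i \<noteq> j \<longrightarrow> \<not> rep_equiv \<Gamma> (\<rho> i) (\<rho> j)) \<and>
     (\<forall>n \<sigma>. irreducible_rep \<Gamma> n \<sigma> \<longrightarrow> (\<exists>i\<in>{1..l}. rep_equiv \<Gamma> \<sigma> (\<rho> i)))"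

definition irreducible_decomposition ::
    "('g, 'c) monoid_scheme \<Rightarrow> ('g \<Rightarrow> complex mat) \<Rightarrow> ('g \<Rightarrow> complex mat) list \<Rightarrow> bool" where
  "irreducible_decomposition \<Gamma> R \<sigma>s \<longleftrightarrow>
     (\<forall>\<sigma>\<in>set \<sigma>s. \<exists>n. irreducible_rep \<Gamma> n \<sigma>) \<and>
     rep_equiv \<Gamma> R (\<lambda>g. diag_block_mat (map (\<lambda>\<sigma>. \<sigma> g) \<sigma>s))"

text \<open>
  The multiplicity of \<open>\<rho>\<close> in \<open>R\<close> is the number of summands equivalent to \<open>\<rho>\<close> in a decomposition of
  \<open>R\<close> into irreducibles. For a finite group such a decomposition exists (Maschke) and the number does
  not depend on the one that is chosen.
\<close>

definition rep_multiplicity ::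
    "('g, 'c) monoid_scheme \<Rightarrow> ('g \<Rightarrow> complex mat) \<Rightarrow> ('g \<Rightarrow> complex mat) \<Rightarrow> nat" where
  "rep_multiplicity \<Gamma> \<rho> R =
     length (filter (rep_equiv \<Gamma> \<rho>) (SOME \<sigma>s. irreducible_decomposition \<Gamma> R \<sigma>s))"

end

theory Submission
  imports Defs
begin

text \<open>
  Listing the vertices of the bundle with the fibre coordinate first, \<open>A - \<mu> D\<close> becomes
  \<open>\<Sum>\<^sub>\<gamma> P(\<gamma>) \<otimes> A\<^sub>\<gamma> - I \<otimes> \<mu> (D(G) + |S| I) + (\<Sum>\<^sub>s P(s)) \<otimes> I\<close>, an expression that makes
  sense for every representation \<open>R\<close> in place of \<open>P\<close>. It turns an equivalence of representations
  into a similarity of matrices (conjugate by \<open>T \<otimes> I\<close>) and a direct sum into a block diagonal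
  matrix. The permutation representation is unitary, so it splits into irreducibles by passing
  to orthogonal complements; evaluating the expression on the decomposition, replacing each
  summand by the equivalent \<open>\<rho>\<^sub>i\<close> and sorting the blocks gives the claim. Since multiplicities are read
  off one chosen decomposition, only the existence of a decomposition is needed.
\<close>

section \<open>Kronecker products, block diagonal matrices and matrix sums\<close>

text \<open>What allows \<open>P\<close> to be replaced by an arbitrary representation is that the
  degree term does not see the fibre: every vertex (u, v) over u has degree deg u + |S|, because
  each arc at u lifts to exactly one arc at (u, v) and F is regular. This term is thus I \<otimes>
  D, and conjugation by T \<otimes> I fixes it. With the representation in the left Kronecker
  factor, the blocks of R become blocks of the whole matrix, scaled by the number of vertices of G.
  One T has to serve all group elements at once, since the sum over \<Gamma> is conjugated as a
  whole; pointwise similarity would not do. Orthogonal complements appear only through matrix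
  entries. In an orthonormal basis adapted to an invariant subspace, the lower left block of U* R(g)
  U vanishes by invariance, and the upper right block vanishes because it is the adjoint of the
  lower left block belonging to the inverse of g. Changing the basis by a unitary U keeps the two
  diagonal blocks unitary, so that the splitting can be repeated on them.\<close>

lemma kronecker_carrier:
  assumes "A \<in> carrier_mat a b" and "B \<in> carrier_mat c d"
  shows "kronecker A B \<in> carrier_mat (a * c) (b * d)"
  using assms by (auto simp: kronecker_def)

lemma kronecker_index:
  assumes "A \<in> carrier_mat a b" and "B \<in> carrier_mat c d" and "i < a * c" and "j < b * d"
  shows "kronecker A B $$ (i, j) = A $$ (i div c, j div d) * B $$ (i mod c, j mod d)"
  using assms by (auto simp: kronecker_def)

text \<open>Writing k as i * b + j matches a single index with a pair; this is how sums over
  Kronecker indices become double sums.\<close>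

lemma sum_div_mod_eq:
  fixes g :: "nat \<Rightarrow> nat \<Rightarrow> 'c :: comm_monoid_add"
  shows "(\<Sum>k<a * b. g (k div b) (k mod b)) = (\<Sum>i<a. \<Sum>j<b. g i j)"
proof (cases "b = 0")
  case False
  have "(\<Sum>i<a. \<Sum>j<b. g i j) = (\<Sum>(i, j)\<in>{..<a} \<times> {..<b}. g i j)"
    by (rule sum.cartesian_product)
  also have "\<dots> = (\<Sum>k<a * b. g (k div b) (k mod b))"
  proof (rule sum.reindex_bij_witness[where i = "\<lambda>k. (k div b, k mod b)" and j = "\<lambda>(i, j). i * b + j"])
    fix x assume "x \<in> {..<a} \<times> {..<b}"
    then obtain i j where x: "x = (i, j)" and ij: "i < a" "j < b" by auto
    have "Suc i * b \<le> a * b" using ij by (intro mult_le_mono1) auto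
    then show "(case x of (i, j) \<Rightarrow> i * b + j) \<in> {..<a * b}" using ij x by auto
  qed (use False in \<open>auto simp: less_mult_imp_div_less\<close>)
  finally show ?thesis by simp
qed simp

text \<open>The mixed product rule: the inner index k < b * q splits into \<open>k div q\<close> and
  \<open>k mod q\<close>, and the resulting double sum factors into the entries of
  \<open>A * C\<close> and \<open>B * D\<close>.\<close>

lemma kronecker_mult:
  assumes A: "A \<in> carrier_mat a b" and C: "C \<in> carrier_mat b c"
    and B: "B \<in> carrier_mat p q" and D: "D \<in> carrier_mat q r"
  shows "kronecker A B * kronecker C D = kronecker (A * C) (B * D)"
proof (rule eq_matI)
  have AC: "A * C \<in> carrier_mat a c" and BD: "B * D \<in> carrier_mat p r" using assms by auto
  note [simp] = carrier_matD[OF kronecker_carrier[OF A B]] carrier_matD[OF kronecker_carrier[OF C D]]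
    carrier_matD[OF kronecker_carrier[OF AC BD]]
  fix i j assume "i < dim_row (kronecker (A * C) (B * D))" "j < dim_col (kronecker (A * C) (B * D))"
  then have i: "i < a * p" and j: "j < c * r" by auto
  then have pos: "p \<noteq> 0" "r \<noteq> 0" by (metis mult_0_right not_less_zero)+
  have i': "i div p < a" "i mod p < p" and j': "j div r < c" "j mod r < r"
    using i j pos by (auto simp: less_mult_imp_div_less)
  have "(kronecker A B * kronecker C D) $$ (i, j)
      = (\<Sum>k<b * q. kronecker A B $$ (i, k) * kronecker C D $$ (k, j))"
    using i j by (simp add: scalar_prod_def lessThan_atLeast0)
  also have "\<dots> = (\<Sum>k<b * q. (A $$ (i div p, k div q) * C $$ (k div q, j div r)) *
      (B $$ (i mod p, k mod q) * D $$ (k mod q, j mod r)))"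
    using i j by (intro sum.cong refl) (simp add: kronecker_index[OF A B] kronecker_index[OF C D])
  also have "\<dots> = (\<Sum>x<b. \<Sum>y<q. (A $$ (i div p, x) * C $$ (x, j div r)) *
      (B $$ (i mod p, y) * D $$ (y, j mod r)))"
    by (rule sum_div_mod_eq)
  also have "\<dots> = (A * C) $$ (i div p, j div r) * (B * D) $$ (i mod p, j mod r)"
    using A B C D i' j' by (simp add: scalar_prod_def lessThan_atLeast0 sum_product)
  also have "\<dots> = kronecker (A * C) (B * D) $$ (i, j)"
    using i j by (simp add: kronecker_index[OF AC BD])
  finally show "(kronecker A B * kronecker C D) $$ (i, j) = kronecker (A * C) (B * D) $$ (i, j)" .
qed (use assms in \<open>auto simp: kronecker_def\<close>)

lemma kronecker_one_one: "kronecker (1\<^sub>m a) (1\<^sub>m b) = 1\<^sub>m (a * b)"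
proof (rule eq_matI)
  fix i j assume "i < dim_row (1\<^sub>m (a * b) :: complex mat)" "j < dim_col (1\<^sub>m (a * b) :: complex mat)"
  then have ij: "i < a * b" "j < a * b" by auto
  then have "b \<noteq> 0" by (metis mult_0_right not_less_zero)
  moreover have "i = j" if "i div b = j div b" "i mod b = j mod b"
    using that by (metis div_mult_mod_eq)
  ultimately show "kronecker (1\<^sub>m a) (1\<^sub>m b) $$ (i, j) = 1\<^sub>m (a * b) $$ (i, j)"
    using ij by (auto simp: kronecker_index[of _ a a _ b b] less_mult_imp_div_less)
qed (auto simp: kronecker_def)

lemma kronecker_one_left: "kronecker (1\<^sub>m (Suc 0)) X = X"
  by (rule eq_matI) (auto simp: kronecker_def)

text \<open>Since \<open>x div k < n\<close> means \<open>x < n * k\<close>, the left factor picks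
  its block exactly where the right-hand side does; an index past the boundary is shifted by a
  multiple of k, which keeps its remainder.\<close>

lemma kronecker_four_block_left:
  assumes A: "A \<in> carrier_mat n n" and B: "B \<in> carrier_mat m m" and X: "X \<in> carrier_mat k k"
  shows "kronecker (four_block_mat A (0\<^sub>m n m) (0\<^sub>m m n) B) X
    = four_block_mat (kronecker A X) (0\<^sub>m (n * k) (m * k)) (0\<^sub>m (m * k) (n * k)) (kronecker B X)"
proof (rule eq_matI)
  let ?R = "four_block_mat (kronecker A X) (0\<^sub>m (n * k) (m * k)) (0\<^sub>m (m * k) (n * k)) (kronecker B X)"
  have AB: "four_block_mat A (0\<^sub>m n m) (0\<^sub>m m n) B \<in> carrier_mat (n + m) (n + m)" using A B by auto
  note [simp] = carrier_matD[OF A] carrier_matD[OF B] carrier_matD[OF kronecker_carrier[OF A X]]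
    carrier_matD[OF kronecker_carrier[OF B X]]
  fix i j assume "i < dim_row ?R" "j < dim_col ?R"
  then have ij: "i < (n + m) * k" "j < (n + m) * k" by (auto simp: algebra_simps)
  then have k: "k > 0" by (cases k) auto
  have div: "x div k < n \<longleftrightarrow> x < n * k" for x using k by (simp add: div_less_iff_less_mult)
  have div2: "x div k < n + m \<longleftrightarrow> x < n * k + m * k" for x
    using k by (simp add: div_less_iff_less_mult algebra_simps)
  have sub: "(x - n * k) div k = x div k - n" "(x - n * k) mod k = x mod k" if x: "\<not> x < n * k" for x
  proof -
    obtain y where "x = n * k + y" using x le_Suc_ex[of "n * k" x] by auto
    then show "(x - n * k) div k = x div k - n" "(x - n * k) mod k = x mod k" using k by auto
  qed
  have ij': "i < n * k + m * k" "j < n * k + m * k" using ij by (simp_all add: algebra_simps)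
  have lt: "x - n * k < m * k" if "\<not> x < n * k" "x < n * k + m * k" for x using that by linarith
  have "kronecker (four_block_mat A (0\<^sub>m n m) (0\<^sub>m m n) B) X $$ (i, j)
      = four_block_mat A (0\<^sub>m n m) (0\<^sub>m m n) B $$ (i div k, j div k) * X $$ (i mod k, j mod k)"
    by (rule kronecker_index[OF AB X ij])
  also have "\<dots> = ?R $$ (i, j)"
    using ij' k
    by (cases "i < n * k"; cases "j < n * k")
      (simp_all add: kronecker_index[OF A X] kronecker_index[OF B X] div div2 sub lt,
       simp_all add: div_less_iff_less_mult lt flip: sub)
  finally show "kronecker (four_block_mat A (0\<^sub>m n m) (0\<^sub>m m n) B) X $$ (i, j) = ?R $$ (i, j)" .
qed (use assms in \<open>auto simp: kronecker_def algebra_simps\<close>)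

text \<open>Makes a multiplicity visible as a number of equal blocks, so that the target becomes one
  list of blocks. Multiplicity 0 gives the 0 by 0 matrix on both sides.\<close>

lemma kronecker_one_eq_diag_block_replicate:
  assumes X: "X \<in> carrier_mat k k"
  shows "kronecker (1\<^sub>m r) X = diag_block_mat (replicate r X)"
proof (induction r)
  case 0
  show ?case by (rule eq_matI) (auto simp: kronecker_def)
next
  case (Suc r)
  have "kronecker (1\<^sub>m (Suc r)) X
      = kronecker (four_block_mat (1\<^sub>m (Suc 0)) (0\<^sub>m (Suc 0) r) (0\<^sub>m r (Suc 0)) (1\<^sub>m r)) X"
    by simp
  also have "\<dots> = four_block_mat X (0\<^sub>m k (r * k)) (0\<^sub>m (r * k) k) (kronecker (1\<^sub>m r) X)"
    by (subst kronecker_four_block_left[OF _ _ X]) (auto simp: kronecker_one_left)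
  also have "\<dots> = diag_block_mat (replicate (Suc r) X)"
    using X carrier_matD[OF kronecker_carrier[OF one_carrier_mat[of r] X]]
    by (simp add: Let_def Suc.IH[symmetric])
  finally show ?case .
qed

section \<open>Products, uniqueness and reordering of diagonal blocks\<close>

lemma four_block_diag_mult:
  assumes "A \<in> carrier_mat n n" "A' \<in> carrier_mat n n"
    and "B \<in> carrier_mat m m" "B' \<in> carrier_mat m m"
  shows "four_block_mat A (0\<^sub>m n m) (0\<^sub>m m n) B * four_block_mat A' (0\<^sub>m n m) (0\<^sub>m m n) B'
    = four_block_mat (A * A') (0\<^sub>m n m) (0\<^sub>m m n) (B * B')"
  using assms by (subst mult_four_block_mat[of _ n n _ m _ m _ _ n _ m]) auto

lemma four_block_diag_inject:
  assumes A: "A \<in> carrier_mat n n" "A' \<in> carrier_mat n n"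
    and B: "B \<in> carrier_mat m m" "B' \<in> carrier_mat m m"
    and eq: "four_block_mat A (0\<^sub>m n m) (0\<^sub>m m n) B = four_block_mat A' (0\<^sub>m n m) (0\<^sub>m m n) B'"
  shows "A = A'" "B = B'"
proof -
  have "A $$ (i, j) = A' $$ (i, j)" if "i < n" "j < n" for i j
    using arg_cong[OF eq, of "\<lambda>M. M $$ (i, j)"] that A B by auto
  then show "A = A'" using A by (intro eq_matI) auto
  have "B $$ (i, j) = B' $$ (i, j)" if "i < m" "j < m" for i j
    using arg_cong[OF eq, of "\<lambda>M. M $$ (n + i, n + j)"] that A B by auto
  then show "B = B'" using B by (intro eq_matI) auto
qed

text \<open>The witness is the block permutation matrix that exchanges the two ranges of
  coordinates.\<close>

lemma four_block_diag_swap_similar: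
  fixes A B :: "complex mat"
  assumes A: "A \<in> carrier_mat n n" and B: "B \<in> carrier_mat m m"
  shows "similar_mat (four_block_mat A (0\<^sub>m n m) (0\<^sub>m m n) B) (four_block_mat B (0\<^sub>m m n) (0\<^sub>m n m) A)"
proof -
  define P :: "complex mat" where "P = four_block_mat (0\<^sub>m n m) (1\<^sub>m n) (1\<^sub>m m) (0\<^sub>m m n)"
  define Q :: "complex mat" where "Q = four_block_mat (0\<^sub>m m n) (1\<^sub>m m) (1\<^sub>m n) (0\<^sub>m n m)"
  have PQ: "P * Q = 1\<^sub>m (n + m)" unfolding P_def Q_def
    by (subst mult_four_block_mat[of _ n m _ n _ m _ _ n _ m]) auto
  have QP: "Q * P = 1\<^sub>m (m + n)" unfolding P_def Q_def
    by (subst mult_four_block_mat[of _ m n _ m _ n _ _ m _ n]) auto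
  have PB: "P * four_block_mat B (0\<^sub>m m n) (0\<^sub>m n m) A = four_block_mat (0\<^sub>m n m) A B (0\<^sub>m m n)"
    unfolding P_def using A B by (subst mult_four_block_mat[of _ n m _ n _ m _ _ m _ n]) auto
  have PBQ: "P * four_block_mat B (0\<^sub>m m n) (0\<^sub>m n m) A * Q = four_block_mat A (0\<^sub>m n m) (0\<^sub>m m n) B"
    unfolding PB unfolding Q_def using A B
    by (subst mult_four_block_mat[of _ n m _ n _ m _ _ n _ m]) auto
  have "similar_mat_wit (four_block_mat A (0\<^sub>m n m) (0\<^sub>m m n) B) (four_block_mat B (0\<^sub>m m n) (0\<^sub>m n m) A) P Q"
    using A B QP PBQ by (intro similar_mat_witI[OF PQ]) (auto simp: add.commute[of m n] P_def Q_def)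
  then show ?thesis unfolding similar_mat_def by blast
qed

lemma diag_block_mat_append_similar:
  assumes A: "similar_mat (diag_block_mat As) (diag_block_mat As')"
    and B: "similar_mat (diag_block_mat Bs) (diag_block_mat Bs')"
  shows "similar_mat (diag_block_mat (As @ Bs)) (diag_block_mat (As' @ Bs'))"
proof -
  obtain n where n: "diag_block_mat As \<in> carrier_mat n n" "diag_block_mat As' \<in> carrier_mat n n"
    using similar_matD[OF A] by blast
  obtain m where m: "diag_block_mat Bs \<in> carrier_mat m m" "diag_block_mat Bs' \<in> carrier_mat m m"
    using similar_matD[OF B] by blast
  show ?thesis using similar_mat_four_block_0_0[OF A B n(1) m(1)] n m
    by (simp add: diag_block_mat_append Let_def)
qed

text \<open>By induction the tail matches \<open>Bs\<close> with one copy of \<open>A\<close>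
  removed; a block swap then carries \<open>A\<close> past \<open>Xs\<close> to its place.
  Squareness provides reflexivity of similarity for the parts that stay where they are.\<close>

lemma diag_block_mat_perm_similar:
  fixes As Bs :: "complex mat list"
  assumes "mset As = mset Bs" and "\<And>A. A \<in> set As \<Longrightarrow> square_mat A"
  shows "similar_mat (diag_block_mat As) (diag_block_mat Bs)"
  using assms
proof (induction As arbitrary: Bs)
  case Nil
  then show ?case by (auto intro: similar_mat_refl[of _ 0])
next
  case (Cons A As)
  have "A \<in> set Bs" using Cons.prems(1) by (metis list.set_intros(1) set_mset_mset)
  then obtain Xs Ys where Bs: "Bs = Xs @ A # Ys" by (meson split_list)
  have ms: "mset As = mset (Xs @ Ys)" using Cons.prems(1) Bs by simp
  have sim: "similar_mat (diag_block_mat As) (diag_block_mat (Xs @ Ys))"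
    using Cons.IH[OF ms] Cons.prems(2) by simp
  have sq: "square_mat C" if "C \<in> set (A # Xs @ Ys)" for C
    using Cons.prems(2) that mset_eq_setD[OF ms] by auto
  have refl: "similar_mat (diag_block_mat Zs) (diag_block_mat Zs)" if "set Zs \<subseteq> set (A # Xs @ Ys)" for Zs
  proof -
    have "square_mat (diag_block_mat Zs)" using sq that by (intro diag_block_mat_square) blast
    then show ?thesis by (intro similar_mat_refl[of _ "dim_row (diag_block_mat Zs)"]) auto
  qed
  have swap: "similar_mat (diag_block_mat (A # Xs)) (diag_block_mat (Xs @ [A]))"
  proof -
    have "square_mat A" using sq by simp
    moreover have "square_mat (diag_block_mat Xs)"
      using sq by (intro diag_block_mat_square) simp
    ultimately have "A \<in> carrier_mat (dim_row A) (dim_row A)"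
      "diag_block_mat Xs \<in> carrier_mat (dim_row (diag_block_mat Xs)) (dim_row (diag_block_mat Xs))"
      by auto
    from four_block_diag_swap_similar[OF this] show ?thesis
      using \<open>square_mat A\<close> \<open>square_mat (diag_block_mat Xs)\<close>
      by (simp add: diag_block_mat_last Let_def)
  qed
  have "similar_mat (diag_block_mat ([A] @ As)) (diag_block_mat ([A] @ (Xs @ Ys)))"
    using sim by (intro diag_block_mat_append_similar refl) auto
  moreover have "similar_mat (diag_block_mat ((A # Xs) @ Ys)) (diag_block_mat ((Xs @ [A]) @ Ys))"
    using swap by (intro diag_block_mat_append_similar refl) auto
  ultimately show ?case unfolding Bs using similar_mat_trans by simp
qed

lemma diag_block_mat_concat:
  "diag_block_mat (concat Xss) = diag_block_mat (map diag_block_mat Xss)"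
  by (induction Xss) (auto simp: diag_block_mat_append Let_def)

section \<open>Finite sums of square matrices\<close>

interpretation module_mat: abelian_group "module_mat TYPE(complex) n m" for n m
  by (rule abelian_group_mat)

lemma mat_sum_insert:
  assumes "finite I" "x \<notin> I" "\<And>i. i \<in> insert x I \<Longrightarrow> M i \<in> carrier_mat n n"
  shows "mat_sum n M (insert x I) = M x + mat_sum n M I"
  using assms by (subst module_mat.finsum_insert) (auto simp: module_mat_simps)

lemma mat_sum_carrier:
  assumes "\<And>i. i \<in> I \<Longrightarrow> M i \<in> carrier_mat n n"
  shows "mat_sum n M I \<in> carrier_mat n n"
  using module_mat.finsum_closed[of M I n n] assms by (auto simp: module_mat_simps)

lemma mat_sum_index:
  assumes "finite I" "\<And>i. i \<in> I \<Longrightarrow> M i \<in> carrier_mat n n" "a < n" "b < n"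
  shows "mat_sum n M I $$ (a, b) = (\<Sum>i\<in>I. M i $$ (a, b))"
  using assms
proof (induction I)
  case empty
  then show ?case using module_mat.finsum_empty[of n n M] by (simp add: module_mat_simps)
next
  case (insert x I)
  have "mat_sum n M I \<in> carrier_mat n n" using insert.prems by (intro mat_sum_carrier) auto
  then show ?case using insert by (subst mat_sum_insert) auto
qed

lemma mat_sum_conjugate:
  assumes "finite I" "\<And>i. i \<in> I \<Longrightarrow> M i \<in> carrier_mat n n"
    and P: "P \<in> carrier_mat n n" and Q: "Q \<in> carrier_mat n n"
  shows "mat_sum n (\<lambda>i. P * M i * Q) I = P * mat_sum n M I * Q"
  using assms(1,2)
proof (induction I)
  case empty
  then show ?case using module_mat.finsum_empty[of n n] P Q by (simp add: module_mat_simps)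
next
  case (insert x I)
  have c: "mat_sum n M I \<in> carrier_mat n n" "M x \<in> carrier_mat n n"
    using insert.prems by (auto intro: mat_sum_carrier)
  have "mat_sum n (\<lambda>i. P * M i * Q) (insert x I) = P * M x * Q + P * mat_sum n M I * Q"
    using insert P Q by (subst mat_sum_insert) auto
  also have "\<dots> = P * (M x + mat_sum n M I) * Q"
    using c P Q by (simp add: mult_add_distrib_mat[of _ n n] add_mult_distrib_mat[of _ n n])
  also have "M x + mat_sum n M I = mat_sum n M (insert x I)"
    using insert by (subst mat_sum_insert) auto
  finally show ?case .
qed

section \<open>Orthonormal bases adapted to a subspace\<close>

lemma mat_adjoint_carrier: "A \<in> carrier_mat n m \<Longrightarrow> mat_adjoint A \<in> carrier_mat m n"
  by (auto simp: mat_adjoint_def)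

lemma mat_adjoint_index:
  assumes "A \<in> carrier_mat n m" "i < m" "j < n"
  shows "mat_adjoint A $$ (i, j) = conjugate (A $$ (j, i))"
  using assms by (auto simp: mat_adjoint_def mat_of_rows_def)

lemma mat_adjoint_mult:
  fixes A B :: "complex mat"
  assumes A: "A \<in> carrier_mat n m" and B: "B \<in> carrier_mat m k"
  shows "mat_adjoint (A * B) = mat_adjoint B * mat_adjoint A"
proof (rule eq_matI)
  have AB: "A * B \<in> carrier_mat n k" using A B by auto
  note c = mat_adjoint_carrier[OF A] mat_adjoint_carrier[OF B] mat_adjoint_carrier[OF AB]
  show "dim_row (mat_adjoint (A * B)) = dim_row (mat_adjoint B * mat_adjoint A)"
    "dim_col (mat_adjoint (A * B)) = dim_col (mat_adjoint B * mat_adjoint A)" using c by auto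
  fix i j assume "i < dim_row (mat_adjoint B * mat_adjoint A)" "j < dim_col (mat_adjoint B * mat_adjoint A)"
  then have ij: "i < k" "j < n" using c by auto
  show "mat_adjoint (A * B) $$ (i, j) = (mat_adjoint B * mat_adjoint A) $$ (i, j)"
    using A B c ij by (simp add: mat_adjoint_index[OF AB] mat_adjoint_index[OF A]
      mat_adjoint_index[OF B] scalar_prod_def mult.commute)
qed

lemma mat_adjoint_adjoint:
  fixes A :: "complex mat"
  shows "mat_adjoint (mat_adjoint A) = A"
proof (rule eq_matI)
  have A: "A \<in> carrier_mat (dim_row A) (dim_col A)" by auto
  note c = mat_adjoint_carrier[OF A] mat_adjoint_carrier[OF mat_adjoint_carrier[OF A]]
  show "dim_row (mat_adjoint (mat_adjoint A)) = dim_row A"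
    "dim_col (mat_adjoint (mat_adjoint A)) = dim_col A" using c by auto
  fix i j assume "i < dim_row A" "j < dim_col A"
  then show "mat_adjoint (mat_adjoint A) $$ (i, j) = A $$ (i, j)"
    by (simp add: mat_adjoint_index[OF mat_adjoint_carrier[OF A]] mat_adjoint_index[OF A])
qed

lemma mat_adjoint_four_block_diag:
  fixes A B :: "complex mat"
  assumes A: "A \<in> carrier_mat n n" and B: "B \<in> carrier_mat m m"
  shows "mat_adjoint (four_block_mat A (0\<^sub>m n m) (0\<^sub>m m n) B)
    = four_block_mat (mat_adjoint A) (0\<^sub>m n m) (0\<^sub>m m n) (mat_adjoint B)"
proof (rule eq_matI)
  let ?L = "four_block_mat A (0\<^sub>m n m) (0\<^sub>m m n) B"
  have L: "?L \<in> carrier_mat (n + m) (n + m)" using A B by auto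
  note c = mat_adjoint_carrier[OF A] mat_adjoint_carrier[OF B] mat_adjoint_carrier[OF L]
  let ?R = "four_block_mat (mat_adjoint A) (0\<^sub>m n m) (0\<^sub>m m n) (mat_adjoint B)"
  show "dim_row (mat_adjoint ?L) = dim_row ?R" "dim_col (mat_adjoint ?L) = dim_col ?R" using c by auto
  fix i j assume "i < dim_row ?R" "j < dim_col ?R"
  then have "i < n + m" "j < n + m" using c by auto
  then show "mat_adjoint ?L $$ (i, j) = ?R $$ (i, j)"
    using A B c by (auto simp: mat_adjoint_index[OF L] mat_adjoint_index[OF A] mat_adjoint_index[OF B])
qed

text \<open>A rectangular left inverse, padded with zeros to a square one, would have a zero row.\<close>

lemma mult_eq_one_dim_le:
  fixes A B :: "complex mat"
  assumes A: "A \<in> carrier_mat n k" and B: "B \<in> carrier_mat k n" and BA: "B * A = 1\<^sub>m k"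
  shows "k \<le> n"
proof (rule ccontr)
  assume "\<not> k \<le> n"
  then have nk: "n < k" by simp
  define A' where "A' = mat k k (\<lambda>(i, j). if i < n then A $$ (i, j) else 0)"
  define B' where "B' = mat k k (\<lambda>(i, j). if j < n then B $$ (i, j) else 0)"
  have c: "A' \<in> carrier_mat k k" "B' \<in> carrier_mat k k" by (auto simp: A'_def B'_def)
  have "B' * A' = B * A"
  proof (rule eq_matI)
    fix i j assume "i < dim_row (B * A)" "j < dim_col (B * A)"
    then have ij: "i < k" "j < k" using A B by auto
    have "(B' * A') $$ (i, j) = (\<Sum>x<k. (if x < n then B $$ (i, x) * A $$ (x, j) else 0))"
      using ij by (auto simp: A'_def B'_def scalar_prod_def lessThan_atLeast0 intro!: sum.cong)
    also have "\<dots> = (\<Sum>x<n. B $$ (i, x) * A $$ (x, j))"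
      using nk by (intro sum.mono_neutral_cong_right) auto
    also have "\<dots> = (B * A) $$ (i, j)"
      using ij A B by (auto simp: scalar_prod_def lessThan_atLeast0)
    finally show "(B' * A') $$ (i, j) = (B * A) $$ (i, j)" .
  qed (use A B c in auto)
  then have "A' * B' = 1\<^sub>m k" using mat_mult_left_right_inverse[OF c(2,1)] BA by simp
  then have "(A' * B') $$ (n, n) = 1" using nk by simp
  moreover have "(A' * B') $$ (n, n) = 0"
    using nk by (auto simp: A'_def B'_def scalar_prod_def)
  ultimately show False by simp
qed

section \<open>Subspaces and maximal orthonormal families\<close>

definition linear_subspace :: "nat \<Rightarrow> complex vec set \<Rightarrow> bool" where
  "linear_subspace n W \<longleftrightarrow> W \<subseteq> carrier_vec n \<and> 0\<^sub>v n \<in> W \<and>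
     (\<forall>v\<in>W. \<forall>w\<in>W. v + w \<in> W) \<and> (\<forall>c. \<forall>w\<in>W. c \<cdot>\<^sub>v w \<in> W)"

text \<open>A failure of irreducibility supplies a \<open>VectorSpace.subspace\<close>; the
  constructions below work with the plain closure properties.\<close>

lemma subspace_imp_linear_subspace:
  assumes "VectorSpace.subspace class_ring W (module_vec TYPE(complex) n)"
  shows "linear_subspace n W"
proof -
  have sub: "submodule class_ring W (module_vec TYPE(complex) n)"
    using assms by (simp add: VectorSpace.subspace_def)
  note closed = submodule.subset[OF sub] submodule.m_closed[OF sub] submodule.smult_closed[OF sub]
    submodule.zero_closed[OF sub]
  show ?thesis
    unfolding linear_subspace_def
    using closed[unfolded module_vec_simps class_ring_simps] by blast
qed

definition orthonormal :: "nat \<Rightarrow> (nat \<Rightarrow> complex vec) \<Rightarrow> bool" where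
  "orthonormal k u \<longleftrightarrow> (\<forall>i<k. \<forall>j<k. u i \<bullet>c u j = (if i = j then 1 else 0))"

abbreviation (input) col_mat :: "nat \<Rightarrow> nat \<Rightarrow> (nat \<Rightarrow> complex vec) \<Rightarrow> complex mat" where
  "col_mat n k u \<equiv> mat n k (\<lambda>(i, j). u j $ i)"

lemma orthonormal_adjoint_mult:
  assumes "orthonormal k u" "\<And>i. i < k \<Longrightarrow> u i \<in> carrier_vec n"
  shows "mat_adjoint (col_mat n k u) * col_mat n k u = 1\<^sub>m k"
proof (rule eq_matI)
  have U: "col_mat n k u \<in> carrier_mat n k" by simp
  note c = mat_adjoint_carrier[OF U]
  fix i j assume "i < dim_row (1\<^sub>m k :: complex mat)" "j < dim_col (1\<^sub>m k :: complex mat)"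
  then have ij: "i < k" "j < k" by auto
  have "(mat_adjoint (col_mat n k u) * col_mat n k u) $$ (i, j)
      = (\<Sum>x<n. conjugate (u i $ x) * u j $ x)"
    using ij c by (simp add: scalar_prod_def lessThan_atLeast0 mat_adjoint_index[OF U])
  also have "\<dots> = u j \<bullet>c u i"
    using assms(2)[OF ij(1)] by (simp add: scalar_prod_def lessThan_atLeast0 mult.commute)
  finally have "(mat_adjoint (col_mat n k u) * col_mat n k u) $$ (i, j) = u j \<bullet>c u i" .
  then show "(mat_adjoint (col_mat n k u) * col_mat n k u) $$ (i, j) = 1\<^sub>m k $$ (i, j)"
    using assms(1) ij by (auto simp: orthonormal_def)
qed (use mat_adjoint_carrier[of "col_mat n k u" n k] in auto)

text \<open>The matrix with these columns has its adjoint as a left inverse, so it cannot have more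
  columns than rows.\<close>

lemma orthonormal_card_le:
  assumes "orthonormal k u" "\<And>i. i < k \<Longrightarrow> u i \<in> carrier_vec n"
  shows "k \<le> n"
  using mult_eq_one_dim_le[OF _ _ orthonormal_adjoint_mult[OF assms]]
    mat_adjoint_carrier[of "col_mat n k u" n k] by auto

text \<open>Take a longest orthonormal family in \<open>W\<close> that extends the given one;
  lengths are bounded by n. A nonzero vector of \<open>W\<close> orthogonal to all its members could
  be normalised and appended. Fixing the first k vectors allows a family for a subspace to be
  continued to the whole space.\<close>

lemma orthonormal_extend_maximal:
  assumes W: "linear_subspace n W" and u: "orthonormal k u" "\<And>i. i < k \<Longrightarrow> u i \<in> W"
  obtains k' u' where "k \<le> k'" "\<And>i. i < k \<Longrightarrow> u' i = u i" "orthonormal k' u'"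
    "\<And>i. i < k' \<Longrightarrow> u' i \<in> W"
    "\<And>w. w \<in> W \<Longrightarrow> (\<And>i. i < k' \<Longrightarrow> w \<bullet>c u' i = 0) \<Longrightarrow> w = 0\<^sub>v n"
proof -
  define P where "P k' \<longleftrightarrow>
    k \<le> k' \<and> (\<exists>u'. (\<forall>i<k. u' i = u i) \<and> orthonormal k' u' \<and> (\<forall>i<k'. u' i \<in> W))" for k'
  have Wn: "w \<in> carrier_vec n" if "w \<in> W" for w using W that by (auto simp: linear_subspace_def)
  have "P k" using u unfolding P_def by blast
  moreover have "\<forall>y. P y \<longrightarrow> y \<le> n" using orthonormal_card_le Wn unfolding P_def by blast
  ultimately obtain k' where k': "P k'" and max: "\<And>y. P y \<Longrightarrow> y \<le> k'"
    using GreatestI_nat[of P k n] Greatest_le_nat[of P _ n] by blast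
  from k' obtain u' where kk': "k \<le> k'"
    and u': "\<And>i. i < k \<Longrightarrow> u' i = u i" "orthonormal k' u'" "\<And>i. i < k' \<Longrightarrow> u' i \<in> W"
    unfolding P_def by blast
  have "w = 0\<^sub>v n" if w: "w \<in> W" and orth: "\<And>i. i < k' \<Longrightarrow> w \<bullet>c u' i = 0" for w
  proof (rule ccontr)
    assume "w \<noteq> 0\<^sub>v n"
    then have "w \<bullet>c w > 0" using Wn[OF w] by simp
    then have r: "Re (w \<bullet>c w) > 0" "w \<bullet>c w = of_real (Re (w \<bullet>c w))"
      by (auto simp: less_complex_def complex_eq_iff)
    define r where "r = Re (w \<bullet>c w)"
    note r = r[folded r_def]
    \<comment> \<open>The scaling factor is real, so conjugation leaves it alone and it enters the
      norm squared.\<close>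
    define v where "v = of_real (1 / sqrt r) \<cdot>\<^sub>v w"
    have vW: "v \<in> W" using W w by (auto simp: linear_subspace_def v_def)
    have conj_v: "conjugate v = of_real (1 / sqrt r) \<cdot>\<^sub>v conjugate w"
      unfolding v_def by (subst conjugate_smult_vec) (simp add: conjugate_complex_def)
    have "v \<bullet>c v = of_real (1 / sqrt r) * (of_real (1 / sqrt r) * (w \<bullet>c w))"
      unfolding conj_v unfolding v_def using Wn[OF w] by simp
    also have "\<dots> = of_real (1 / sqrt r * (1 / sqrt r) * r)" by (simp only: r(2) of_real_mult mult.assoc)
    also have "1 / sqrt r * (1 / sqrt r) * r = 1" using r(1) by (simp add: field_simps)
    finally have vv: "v \<bullet>c v = 1" by simp
    have vu: "v \<bullet>c u' i = 0" if "i < k'" for i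
      unfolding v_def using orth[OF that] Wn[OF w] Wn[OF u'(3)[OF that]] by simp
    have uv: "u' i \<bullet>c v = 0" if "i < k'" for i
    proof -
      have "u' i \<bullet>c v = conjugate (v \<bullet>c u' i)"
        using conjugate_conjugate_sprod[OF Wn[OF u'(3)[OF that]] Wn[OF vW]]
          conjugate_vec_sprod_comm[OF Wn[OF vW] Wn[OF u'(3)[OF that]]] by simp
      then show ?thesis using vu[OF that] by simp
    qed
    have "orthonormal (Suc k') (u'(k' := v))"
      using u'(2) vv vu uv unfolding orthonormal_def by (auto simp: less_Suc_eq)
    moreover have "\<forall>i<Suc k'. (u'(k' := v)) i \<in> W" using u'(3) vW by (auto simp: less_Suc_eq)
    moreover have "\<forall>i<k. (u'(k' := v)) i = u i" using u'(1) kk' by auto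
    ultimately have "P (Suc k')" using kk' unfolding P_def by (meson le_SucI)
    then show False using max by fastforce
  qed
  then show thesis using that[of k' u'] kk' u' by blast
qed

lemma linear_subspace_combination:
  fixes u :: "nat \<Rightarrow> complex vec"
  assumes "linear_subspace n W" "\<And>i. i < k \<Longrightarrow> u i \<in> W"
  shows "vec n (\<lambda>i. \<Sum>j<k. c j * u j $ i) \<in> W"
  using assms(2)
proof (induction k)
  case 0
  have "vec n (\<lambda>i. \<Sum>j<0. c j * u j $ i) = 0\<^sub>v n" by auto
  then show ?case using assms(1) by (simp add: linear_subspace_def)
next
  case (Suc k)
  have "u k \<in> W" using Suc.prems by simp
  moreover have "u k \<in> carrier_vec n" using \<open>u k \<in> W\<close> assms(1) by (auto simp: linear_subspace_def)
  then have "vec n (\<lambda>i. \<Sum>j<Suc k. c j * u j $ i)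
      = vec n (\<lambda>i. \<Sum>j<k. c j * u j $ i) + c k \<cdot>\<^sub>v u k" by auto
  moreover have "vec n (\<lambda>i. \<Sum>j<k. c j * u j $ i) \<in> W" using Suc by simp
  ultimately show ?case using assms(1) by (simp add: linear_subspace_def)
qed

lemma combination_cscalar_prod:
  fixes u :: "nat \<Rightarrow> complex vec"
  assumes "\<And>i. i < k \<Longrightarrow> u i \<in> carrier_vec n" and v: "v \<in> carrier_vec n"
  shows "vec n (\<lambda>i. \<Sum>j<k. c j * u j $ i) \<bullet>c v = (\<Sum>j<k. c j * (u j \<bullet>c v))"
proof -
  have "vec n (\<lambda>i. \<Sum>j<k. c j * u j $ i) \<bullet>c v = (\<Sum>i<n. \<Sum>j<k. c j * u j $ i * conjugate v $ i)"
    using v by (simp add: scalar_prod_def lessThan_atLeast0 sum_distrib_right)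
  also have "\<dots> = (\<Sum>j<k. \<Sum>i<n. c j * u j $ i * conjugate v $ i)" by (rule sum.swap)
  also have "\<dots> = (\<Sum>j<k. c j * (u j \<bullet>c v))"
    using assms by (simp add: scalar_prod_def lessThan_atLeast0 sum_distrib_left mult.assoc)
  finally show ?thesis .
qed

text \<open>The difference between w and its projection lies in \<open>W\<close> and is orthogonal
  to the family, so maximality makes it zero.\<close>

lemma orthonormal_expansion:
  assumes W: "linear_subspace n W" and u: "orthonormal k u" "\<And>i. i < k \<Longrightarrow> u i \<in> W"
    and max: "\<And>w. w \<in> W \<Longrightarrow> (\<And>i. i < k \<Longrightarrow> w \<bullet>c u i = 0) \<Longrightarrow> w = 0\<^sub>v n"
    and w: "w \<in> W"
  shows "w = vec n (\<lambda>i. \<Sum>j<k. (w \<bullet>c u j) * u j $ i)"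
proof -
  let ?p = "vec n (\<lambda>i. \<Sum>j<k. (w \<bullet>c u j) * u j $ i)"
  have Wn: "w \<in> carrier_vec n" if "w \<in> W" for w using W that by (auto simp: linear_subspace_def)
  have p: "?p \<in> W" by (rule linear_subspace_combination[OF W u(2)])
  \<comment> \<open>The difference is written with a scalar multiple because
    \<open>linear_subspace\<close> offers closure under sums and scalar multiples.\<close>
  have "w + (-1) \<cdot>\<^sub>v ?p = 0\<^sub>v n"
  proof (rule max)
    have "(-1) \<cdot>\<^sub>v ?p \<in> W" using W p unfolding linear_subspace_def by blast
    then show "w + (-1) \<cdot>\<^sub>v ?p \<in> W" using W w unfolding linear_subspace_def by blast
    fix i assume i: "i < k"
    have "?p \<bullet>c u i = (\<Sum>j<k. (w \<bullet>c u j) * (u j \<bullet>c u i))"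
      by (rule combination_cscalar_prod) (use u(2) Wn i in auto)
    also have "\<dots> = (\<Sum>j<k. if j = i then w \<bullet>c u i else 0)"
      using u(1) i by (intro sum.cong) (auto simp: orthonormal_def)
    also have "\<dots> = w \<bullet>c u i" using i by simp
    finally have pi: "?p \<bullet>c u i = w \<bullet>c u i" .
    have "(w + (-1) \<cdot>\<^sub>v ?p) \<bullet>c u i = w \<bullet>c u i + ((-1) \<cdot>\<^sub>v ?p) \<bullet>c u i"
      by (rule add_scalar_prod_distrib[of _ n]) (use Wn[OF w] Wn[OF u(2)[OF i]] in auto)
    also have "((-1) \<cdot>\<^sub>v ?p) \<bullet>c u i = (-1) * (?p \<bullet>c u i)"
      by (rule smult_scalar_prod_distrib[of _ n]) (use Wn[OF u(2)[OF i]] in auto)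
    finally have "(w + (-1) \<cdot>\<^sub>v ?p) \<bullet>c u i = w \<bullet>c u i + (-1) * (?p \<bullet>c u i)" .
    then show "(w + (-1) \<cdot>\<^sub>v ?p) \<bullet>c u i = 0" using pi by simp
  qed
  then have "(w + (-1) \<cdot>\<^sub>v ?p) $ i = 0" if "i < n" for i using that by simp
  then show ?thesis using Wn[OF w] by (intro eq_vecI) auto
qed

text \<open>A maximal family of \<open>W\<close> is extended to a maximal family of the whole space.
  The last two conclusions turn a proper nonzero \<open>W\<close> into 0 < k < n, which makes both
  blocks of the later splitting nonempty.\<close>

lemma linear_subspace_adapted_basis:
  assumes W: "linear_subspace n W"
  obtains k u where "k \<le> n" "orthonormal n u" "\<And>i. i < n \<Longrightarrow> u i \<in> carrier_vec n"
    "\<And>i. i < k \<Longrightarrow> u i \<in> W" "\<And>w j. w \<in> W \<Longrightarrow> k \<le> j \<Longrightarrow> j < n \<Longrightarrow> w \<bullet>c u j = 0"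
    "k = 0 \<Longrightarrow> W = {0\<^sub>v n}" "k = n \<Longrightarrow> W = carrier_vec n"
proof -
  have Wn: "w \<in> carrier_vec n" if "w \<in> W" for w using W that by (auto simp: linear_subspace_def)
  have C: "linear_subspace n (carrier_vec n)" by (auto simp: linear_subspace_def)
  obtain k u where u: "orthonormal k u" "\<And>i. i < k \<Longrightarrow> u i \<in> W"
    and max: "\<And>w. w \<in> W \<Longrightarrow> (\<And>i. i < k \<Longrightarrow> w \<bullet>c u i = 0) \<Longrightarrow> w = 0\<^sub>v n"
    using orthonormal_extend_maximal[OF W, of 0 "\<lambda>_. 0\<^sub>v n"] by (auto simp: orthonormal_def)
  obtain k' u' where k': "k \<le> k'" and ext: "\<And>i. i < k \<Longrightarrow> u' i = u i" and u': "orthonormal k' u'"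
    "\<And>i. i < k' \<Longrightarrow> u' i \<in> carrier_vec n"
    and max': "\<And>w. w \<in> carrier_vec n \<Longrightarrow> (\<And>i. i < k' \<Longrightarrow> w \<bullet>c u' i = 0) \<Longrightarrow> w = 0\<^sub>v n"
    \<comment> \<open>The second extension starts from the family found for \<open>W\<close>, so
      \<open>u'\<close> and \<open>u\<close> agree below k.\<close>
    using orthonormal_extend_maximal[OF C u(1)] u(2) Wn by metis
  have exp: "w = vec n (\<lambda>i. \<Sum>j<k. (w \<bullet>c u j) * u j $ i)" if "w \<in> W" for w
    by (rule orthonormal_expansion[OF W u max that])
  have exp': "w = vec n (\<lambda>i. \<Sum>j<k'. (w \<bullet>c u' j) * u' j $ i)" if "w \<in> carrier_vec n" for w
    by (rule orthonormal_expansion[OF C u' max' that])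
  let ?U = "col_mat n k' u'"
  have U: "?U \<in> carrier_mat n k'" by simp
  \<comment> \<open>Column j of this product is the expansion of the j-th unit vector, whose
    coefficients are the conjugated j-th coordinates of the family.\<close>
  have "?U * mat_adjoint ?U = 1\<^sub>m n"
  proof (rule eq_matI)
    fix i j assume "i < dim_row (1\<^sub>m n :: complex mat)" "j < dim_col (1\<^sub>m n :: complex mat)"
    then have ij: "i < n" "j < n" by auto
    have e: "unit_vec n j \<bullet>c u' l = conjugate (u' l $ j)" if "l < k'" for l
      using ij u'(2)[OF that] by (subst scalar_prod_left_unit[of _ n]) auto
    have "(?U * mat_adjoint ?U) $$ (i, j) = (\<Sum>l<k'. u' l $ i * conjugate (u' l $ j))"
      using ij mat_adjoint_carrier[OF U] by (auto simp: scalar_prod_def lessThan_atLeast0 mat_adjoint_index[OF U])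
    also have "\<dots> = vec n (\<lambda>i. \<Sum>l<k'. (unit_vec n j \<bullet>c u' l) * u' l $ i) $ i"
      using ij e by (simp add: mult.commute)
    also have "\<dots> = unit_vec n j $ i" using exp'[of "unit_vec n j"] by simp
    finally show "(?U * mat_adjoint ?U) $$ (i, j) = 1\<^sub>m n $$ (i, j)" using ij by auto
  qed (use mat_adjoint_carrier[OF U] in auto)
  \<comment> \<open>Here \<open>?U\<close> is a left inverse of its adjoint, a matrix with n
    columns; this bounds n by k'. The other inequality is
    \<open>orthonormal_card_le\<close>.\<close>
  then have "n \<le> k'" by (rule mult_eq_one_dim_le[OF mat_adjoint_carrier[OF U] U])
  then have k'n: "k' = n" using orthonormal_card_le[OF u'] by simp
  show thesis
  proof (rule that[of k u'])
    show "k \<le> n" "orthonormal n u'" "\<And>i. i < n \<Longrightarrow> u' i \<in> carrier_vec n" using k' u' k'n by auto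
    show "u' i \<in> W" if "i < k" for i using ext u(2) that by simp
    \<comment> \<open>A vector of \<open>W\<close> is a combination of the first k members, and
      these are orthogonal to all later ones.\<close>
    show "w \<bullet>c u' j = 0" if "w \<in> W" "k \<le> j" "j < n" for w j
    proof -
      have "w \<bullet>c u' j = vec n (\<lambda>i. \<Sum>j<k. (w \<bullet>c u j) * u j $ i) \<bullet>c u' j"
        using exp[OF that(1)] by simp
      also have "\<dots> = (\<Sum>l<k. (w \<bullet>c u l) * (u l \<bullet>c u' j))"
        by (rule combination_cscalar_prod) (use u(2) Wn u'(2) that k'n in auto)
      also have "\<dots> = (\<Sum>l<k. (w \<bullet>c u l) * (u' l \<bullet>c u' j))" using ext by simp
      also have "\<dots> = 0" using u'(1) that k'n by (intro sum.neutral) (auto simp: orthonormal_def)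
      finally show ?thesis .
    qed
    show "W = {0\<^sub>v n}" if "k = 0"
      using max that W by (auto simp: linear_subspace_def)
    show "W = carrier_vec n" if "k = n"
    proof
      show "W \<subseteq> carrier_vec n" using Wn by blast
      have "w \<in> W" if w: "w \<in> carrier_vec n" for w
      proof -
        have "vec n (\<lambda>i. \<Sum>j<k'. (w \<bullet>c u' j) * u' j $ i) \<in> W"
          by (rule linear_subspace_combination[OF W]) (use ext u(2) k'n \<open>k = n\<close> in auto)
        then show ?thesis using exp'[OF w] by simp
      qed
      then show "carrier_vec n \<subseteq> W" by blast
    qed
  qed
qed

section \<open>Decomposition of unitary representations\<close>

lemma rep_equiv_sym: "rep_equiv \<Gamma> \<rho> \<sigma> \<Longrightarrow> rep_equiv \<Gamma> \<sigma> \<rho>"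
  unfolding rep_equiv_def using similar_mat_wit_sym by blast

lemma rep_equiv_trans: "rep_equiv \<Gamma> \<rho> \<sigma> \<Longrightarrow> rep_equiv \<Gamma> \<sigma> \<tau> \<Longrightarrow> rep_equiv \<Gamma> \<rho> \<tau>"
  unfolding rep_equiv_def using similar_mat_wit_trans by blast

lemma rep_equiv_refl:
  assumes "matrix_rep \<Gamma> n \<rho>"
  shows "rep_equiv \<Gamma> \<rho> \<rho>"
  using assms similar_mat_wit_refl unfolding rep_equiv_def matrix_rep_def by blast

lemma rep_equiv_four_block:
  assumes A: "rep_equiv \<Gamma> A A'" "\<And>g. g \<in> carrier \<Gamma> \<Longrightarrow> A g \<in> carrier_mat n n"
    and B: "rep_equiv \<Gamma> B B'" "\<And>g. g \<in> carrier \<Gamma> \<Longrightarrow> B g \<in> carrier_mat m m"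
  shows "rep_equiv \<Gamma> (\<lambda>g. four_block_mat (A g) (0\<^sub>m n m) (0\<^sub>m m n) (B g))
    (\<lambda>g. four_block_mat (A' g) (0\<^sub>m n m) (0\<^sub>m m n) (B' g))"
proof -
  obtain P P' where P: "\<And>g. g \<in> carrier \<Gamma> \<Longrightarrow> similar_mat_wit (A g) (A' g) P P'"
    using A unfolding rep_equiv_def by blast
  obtain Q Q' where Q: "\<And>g. g \<in> carrier \<Gamma> \<Longrightarrow> similar_mat_wit (B g) (B' g) Q Q'"
    using B unfolding rep_equiv_def by blast
  have "similar_mat_wit (four_block_mat (A g) (0\<^sub>m n m) (0\<^sub>m m n) (B g))
      (four_block_mat (A' g) (0\<^sub>m n m) (0\<^sub>m m n) (B' g))
      (four_block_mat P (0\<^sub>m n m) (0\<^sub>m m n) Q) (four_block_mat P' (0\<^sub>m n m) (0\<^sub>m m n) Q')"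
    if g: "g \<in> carrier \<Gamma>" for g
  proof (rule similar_mat_wit_four_block[OF P[OF g] Q[OF g] _ _ A(2)[OF g] B(2)[OF g]])
    note w = similar_mat_witD2[OF A(2)[OF g] P[OF g]] similar_mat_witD2[OF B(2)[OF g] Q[OF g]]
    show "0\<^sub>m n m = P * 0\<^sub>m n m * Q'" "0\<^sub>m m n = Q * 0\<^sub>m m n * P'" using w by auto
  qed auto
  then show ?thesis unfolding rep_equiv_def by blast
qed

text \<open>R of the inverse is a left inverse of R g and the adjoint is a right inverse, so the two
  coincide.\<close>

lemma unitary_rep_inverse:
  fixes \<Gamma> (structure)
  assumes "group \<Gamma>" and R: "unitary_rep \<Gamma> n R" and g: "g \<in> carrier \<Gamma>"
  shows "R (inv\<^bsub>\<Gamma>\<^esub> g) = mat_adjoint (R g)"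
proof -
  interpret group \<Gamma> by fact
  have c: "R g \<in> carrier_mat n n" "R (inv g) \<in> carrier_mat n n" "mat_adjoint (R g) \<in> carrier_mat n n"
    using R g by (auto simp: unitary_rep_def matrix_rep_def intro: mat_adjoint_carrier)
  have "R (inv g \<otimes> g) = R (inv g) * R g" "R \<one> = 1\<^sub>m n" "R g * mat_adjoint (R g) = 1\<^sub>m n"
    using R g inv_closed[OF g] unfolding unitary_rep_def matrix_rep_def by blast+
  then have 1: "R (inv g) * R g = 1\<^sub>m n" "R g * mat_adjoint (R g) = 1\<^sub>m n" using l_inv[OF g] by auto
  have "R (inv g) = R (inv g) * (R g * mat_adjoint (R g))" using 1 c by simp
  also have "\<dots> = (R (inv g) * R g) * mat_adjoint (R g)" by (rule assoc_mult_mat[OF c(2,1,3), symmetric])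
  also have "\<dots> = mat_adjoint (R g)" using 1 c by simp
  finally show ?thesis .
qed

text \<open>U is square, so its left inverse U* is also a right inverse. Conjugating by a unitary
  matrix, rather than an arbitrary invertible one, is what preserves unitarity.\<close>

lemma unitary_rep_conjugate:
  assumes R: "unitary_rep \<Gamma> n R" and U: "U \<in> carrier_mat n n" and UU: "mat_adjoint U * U = 1\<^sub>m n"
  shows "unitary_rep \<Gamma> n (\<lambda>g. mat_adjoint U * R g * U)"
    and "rep_equiv \<Gamma> R (\<lambda>g. mat_adjoint U * R g * U)"
proof -
  let ?V = "mat_adjoint U"
  have V: "?V \<in> carrier_mat n n" by (rule mat_adjoint_carrier[OF U])
  have UV: "U * ?V = 1\<^sub>m n" by (rule mat_mult_left_right_inverse[OF V U UU])
  have Rc: "R g \<in> carrier_mat n n" if "g \<in> carrier \<Gamma>" for g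
    using R that by (auto simp: unitary_rep_def matrix_rep_def)
  have ass: "A * B * C = A * (B * C)" if "A \<in> carrier_mat n n" "B \<in> carrier_mat n n" "C \<in> carrier_mat n n"
    for A B C :: "complex mat"
    using that by (rule assoc_mult_mat)
  have mul: "?V * A * U * (?V * B * U) = ?V * (A * B) * U"
    if A: "A \<in> carrier_mat n n" and B: "B \<in> carrier_mat n n" for A B
  proof -
    have "?V * A * U * (?V * B * U) = ?V * A * (U * ?V) * (B * U)"
      using A B U V by (simp add: ass)
    also have "\<dots> = ?V * (A * B) * U" using A B U V by (simp add: UV ass)
    finally show ?thesis .
  qed
  have adj: "mat_adjoint (?V * A * U) = ?V * mat_adjoint A * U" if A: "A \<in> carrier_mat n n" for A
  proof -
    have "mat_adjoint (?V * A * U) = ?V * (mat_adjoint A * mat_adjoint ?V)"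
      using A U V by (subst mat_adjoint_mult[of _ n n]) (auto simp: mat_adjoint_mult[of _ n n])
    then show ?thesis using A U V mat_adjoint_carrier[OF A] by (simp add: mat_adjoint_adjoint ass)
  qed
  show "unitary_rep \<Gamma> n (\<lambda>g. ?V * R g * U)"
    unfolding unitary_rep_def matrix_rep_def
  proof (intro conjI ballI)
    show "?V * R g * U \<in> carrier_mat n n" if "g \<in> carrier \<Gamma>" for g using U V Rc[OF that] by auto
    show "?V * R \<one>\<^bsub>\<Gamma>\<^esub> * U = 1\<^sub>m n"
      using R U V UU by (simp add: unitary_rep_def matrix_rep_def)
    show "?V * R (g \<otimes>\<^bsub>\<Gamma>\<^esub> h) * U = ?V * R g * U * (?V * R h * U)"
      if "g \<in> carrier \<Gamma>" "h \<in> carrier \<Gamma>" for g h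
      using R that by (simp add: mul[OF Rc Rc] unitary_rep_def matrix_rep_def)
    show "?V * R g * U * mat_adjoint (?V * R g * U) = 1\<^sub>m n" if g: "g \<in> carrier \<Gamma>" for g
    proof -
      have "R g * mat_adjoint (R g) = 1\<^sub>m n" using R g by (simp add: unitary_rep_def)
      then show ?thesis
        using U V UU by (simp add: adj[OF Rc[OF g]] mul[OF Rc[OF g] mat_adjoint_carrier[OF Rc[OF g]]])
    qed
  qed
  have "similar_mat_wit (R g) (?V * R g * U) U ?V" if g: "g \<in> carrier \<Gamma>" for g
  proof (rule similar_mat_witI[OF UV UU])
    have "U * (?V * R g * U) * ?V = (U * ?V) * R g * (U * ?V)"
      using U V Rc[OF g] by (simp add: ass)
    then show "R g = U * (?V * R g * U) * ?V" using Rc[OF g] by (simp add: UV)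
  qed (use U V Rc[OF g] in auto)
  then show "rep_equiv \<Gamma> R (\<lambda>g. ?V * R g * U)" unfolding rep_equiv_def by blast
qed

text \<open>Each law of a unitary representation is an equation between block diagonal matrices and
  can be read off in the two blocks separately.\<close>

lemma unitary_rep_four_block:
  fixes \<Gamma> (structure)
  assumes R: "unitary_rep \<Gamma> (n + m) R" and "group \<Gamma>"
    and A: "\<And>g. g \<in> carrier \<Gamma> \<Longrightarrow> A g \<in> carrier_mat n n"
    and B: "\<And>g. g \<in> carrier \<Gamma> \<Longrightarrow> B g \<in> carrier_mat m m"
    and eq: "\<And>g. g \<in> carrier \<Gamma> \<Longrightarrow> R g = four_block_mat (A g) (0\<^sub>m n m) (0\<^sub>m m n) (B g)"
  shows "unitary_rep \<Gamma> n A" "unitary_rep \<Gamma> m B"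
proof -
  interpret group \<Gamma> by fact
  note [simp] = A B mat_adjoint_carrier[OF A] mat_adjoint_carrier[OF B]
  have one: "A \<one> = 1\<^sub>m n \<and> B \<one> = 1\<^sub>m m"
  proof -
    have "four_block_mat (A \<one>) (0\<^sub>m n m) (0\<^sub>m m n) (B \<one>)
        = four_block_mat (1\<^sub>m n) (0\<^sub>m n m) (0\<^sub>m m n) (1\<^sub>m m)"
      using R eq[OF one_closed] by (simp add: unitary_rep_def matrix_rep_def)
    from four_block_diag_inject[OF _ _ _ _ this] show ?thesis by simp
  qed
  have mult: "A (g \<otimes> h) = A g * A h \<and> B (g \<otimes> h) = B g * B h"
    if g: "g \<in> carrier \<Gamma>" and h: "h \<in> carrier \<Gamma>" for g h
  proof -
    have "R (g \<otimes> h) = R g * R h" using R g h by (simp add: unitary_rep_def matrix_rep_def)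
    then have "four_block_mat (A (g \<otimes> h)) (0\<^sub>m n m) (0\<^sub>m m n) (B (g \<otimes> h))
        = four_block_mat (A g * A h) (0\<^sub>m n m) (0\<^sub>m m n) (B g * B h)"
      using g h by (simp add: eq four_block_diag_mult)
    from four_block_diag_inject[OF _ _ _ _ this] g h show ?thesis
      using mult_carrier_mat[OF A[OF g] A[OF h]] mult_carrier_mat[OF B[OF g] B[OF h]] by simp
  qed
  have unit: "A g * mat_adjoint (A g) = 1\<^sub>m n \<and> B g * mat_adjoint (B g) = 1\<^sub>m m"
    if g: "g \<in> carrier \<Gamma>" for g
  proof -
    have "R g * mat_adjoint (R g) = 1\<^sub>m (n + m)" using R g by (simp add: unitary_rep_def)
    then have "four_block_mat (A g * mat_adjoint (A g)) (0\<^sub>m n m) (0\<^sub>m m n) (B g * mat_adjoint (B g))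
        = four_block_mat (1\<^sub>m n) (0\<^sub>m n m) (0\<^sub>m m n) (1\<^sub>m m)"
      using g by (simp add: eq four_block_diag_mult mat_adjoint_four_block_diag)
    from four_block_diag_inject[OF _ _ _ _ this] g show ?thesis
      using mult_carrier_mat[OF A[OF g] mat_adjoint_carrier[OF A[OF g]]]
        mult_carrier_mat[OF B[OF g] mat_adjoint_carrier[OF B[OF g]]] by simp
  qed
  show "unitary_rep \<Gamma> n A" "unitary_rep \<Gamma> m B"
    using one mult unit by (simp_all add: unitary_rep_def matrix_rep_def)
qed

text \<open>The first k columns of U lie in \<open>W\<close> and the other columns are orthogonal to
  \<open>W\<close>. Both off-diagonal blocks of U* R(g) U vanish, which amounts to the invariance of
  \<open>W\<close> and of its orthogonal complement.\<close>

lemma reducible_unitary_rep_splits: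
  fixes \<Gamma> (structure)
  assumes "group \<Gamma>" and R: "unitary_rep \<Gamma> n R" and W: "linear_subspace n W"
    and inv: "\<And>g w. g \<in> carrier \<Gamma> \<Longrightarrow> w \<in> W \<Longrightarrow> R g *\<^sub>v w \<in> W"
    and nontriv: "W \<noteq> {0\<^sub>v n}" "W \<noteq> carrier_vec n"
  obtains p q A B where "n = p + q" "0 < p" "0 < q" "unitary_rep \<Gamma> p A" "unitary_rep \<Gamma> q B"
    "rep_equiv \<Gamma> R (\<lambda>g. four_block_mat (A g) (0\<^sub>m p q) (0\<^sub>m q p) (B g))"
proof -
  interpret group \<Gamma> by fact
  obtain k u where k: "k \<le> n" and u: "orthonormal n u" "\<And>i. i < n \<Longrightarrow> u i \<in> carrier_vec n"
    and uW: "\<And>i. i < k \<Longrightarrow> u i \<in> W" and orth: "\<And>w j. w \<in> W \<Longrightarrow> k \<le> j \<Longrightarrow> j < n \<Longrightarrow> w \<bullet>c u j = 0"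
    and k0: "k = 0 \<Longrightarrow> W = {0\<^sub>v n}" and kn: "k = n \<Longrightarrow> W = carrier_vec n"
    using linear_subspace_adapted_basis[OF W] by blast
  define U where "U = col_mat n n u"
  let ?Q = "\<lambda>g. mat_adjoint U * R g * U"
  have U: "U \<in> carrier_mat n n" by (simp add: U_def)
  have V: "mat_adjoint U \<in> carrier_mat n n" by (rule mat_adjoint_carrier[OF U])
  note conj = unitary_rep_conjugate[OF R U orthonormal_adjoint_mult[OF u, folded U_def]]
  have Rc: "R g \<in> carrier_mat n n" if "g \<in> carrier \<Gamma>" for g
    using R that by (auto simp: unitary_rep_def matrix_rep_def)
  have Qc: "?Q g \<in> carrier_mat n n" if "g \<in> carrier \<Gamma>" for g using U V Rc[OF that] by auto
  have colU: "col U j = u j" if "j < n" for j using u(2)[OF that] that by (intro eq_vecI) (auto simp: U_def)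
  have rowV: "row (mat_adjoint U) i = conjugate (u i)" if "i < n" for i
    using u(2)[OF that] that V by (intro eq_vecI) (auto simp: mat_adjoint_index[OF U], simp add: U_def)
  \<comment> \<open>Entry (i, j) is the inner product of \<open>R g *\<^sub>v u j\<close> with
    \<open>u i\<close>; the first vector stays in \<open>W\<close> and the second is orthogonal to
    \<open>W\<close>.\<close>
  have lower: "?Q g $$ (i, j) = 0" if g: "g \<in> carrier \<Gamma>" and ij: "k \<le> i" "i < n" "j < k" for g i j
  proof -
    have j: "j < n" using ij k by simp
    have "?Q g = mat_adjoint U * (R g * U)" by (rule assoc_mult_mat[OF V Rc[OF g] U])
    then have "?Q g $$ (i, j) = row (mat_adjoint U) i \<bullet> col (R g * U) j"
      using U V Rc[OF g] ij j by simp
    also have "\<dots> = conjugate (u i) \<bullet> (R g *\<^sub>v u j)"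
      using rowV[OF ij(2)] colU[OF j] col_mult2[OF Rc[OF g] U j] by simp
    also have "\<dots> = (R g *\<^sub>v u j) \<bullet>c u i"
      using Rc[OF g] u(2)[OF j] u(2)[OF ij(2)] by (subst conjugate_vec_sprod_comm[of _ n]) auto
    also have "\<dots> = 0" by (rule orth[OF inv[OF g uW[OF ij(3)]] ij(1,2)])
    finally show ?thesis .
  qed
  \<comment> \<open>The adjoint of \<open>?Q g\<close> is \<open>?Q\<close> at the inverse of g,
    whose lower block is already known to vanish.\<close>
  have upper: "?Q g $$ (i, j) = 0" if g: "g \<in> carrier \<Gamma>" and ij: "i < k" "k \<le> j" "j < n" for g i j
  proof -
    have "mat_adjoint (?Q g) $$ (j, i) = 0"
      using lower[OF inv_closed[OF g] ij(2,3,1)]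
        unitary_rep_inverse[OF \<open>group \<Gamma>\<close> conj(1) g] by simp
    then show ?thesis using ij k by (subst (asm) mat_adjoint_index[OF Qc[OF g]]) auto
  qed
  define A where "A g = mat k k (\<lambda>(i, j). ?Q g $$ (i, j))" for g
  define B where "B g = mat (n - k) (n - k) (\<lambda>(i, j). ?Q g $$ (k + i, k + j))" for g
  have eq: "?Q g = four_block_mat (A g) (0\<^sub>m k (n - k)) (0\<^sub>m (n - k) k) (B g)"
    if g: "g \<in> carrier \<Gamma>" for g
  proof (rule eq_matI)
    let ?F = "four_block_mat (A g) (0\<^sub>m k (n - k)) (0\<^sub>m (n - k) k) (B g)"
    have F: "?F \<in> carrier_mat (k + (n - k)) (k + (n - k))" by (auto simp: A_def B_def)
    then show "dim_row (?Q g) = dim_row ?F" "dim_col (?Q g) = dim_col ?F"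
      using carrier_matD[OF Qc[OF g]] k by (simp_all only: carrier_matD le_add_diff_inverse)
    define M where "M = ?Q g"
    fix i j assume "i < dim_row ?F" "j < dim_col ?F"
    then have ij: "i < n" "j < n" using F k by auto
    have d: "dim_row (A g) = k" "dim_col (A g) = k" "dim_row (B g) = n - k" "dim_col (B g) = n - k"
      by (auto simp: A_def B_def)
    have "?F $$ (i, j) = (if i < k then if j < k then A g $$ (i, j) else 0\<^sub>m k (n - k) $$ (i, j - k)
      else if j < k then 0\<^sub>m (n - k) k $$ (i - k, j) else B g $$ (i - k, j - k))"
      using ij k d by (subst index_mat_four_block) auto
    also have "\<dots> = M $$ (i, j)"
      using ij k lower[OF g, of i j, folded M_def] upper[OF g, of i j, folded M_def]
      by (auto simp: A_def B_def simp flip: M_def)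
    also have "\<dots> = ?Q g $$ (i, j)" by (simp only: M_def)
    finally show "?Q g $$ (i, j) = ?F $$ (i, j)" ..
  qed
  have AB: "A g \<in> carrier_mat k k" "B g \<in> carrier_mat (n - k) (n - k)" for g by (auto simp: A_def B_def)
  have nk: "n = k + (n - k)" using k by simp
  have Q': "unitary_rep \<Gamma> (k + (n - k)) ?Q" using conj(1) nk by simp
  note AB_rep = unitary_rep_four_block[OF Q' \<open>group \<Gamma>\<close> AB eq]
  have "rep_equiv \<Gamma> R (\<lambda>g. four_block_mat (A g) (0\<^sub>m k (n - k)) (0\<^sub>m (n - k) k) (B g))"
    using conj(2) eq unfolding rep_equiv_def by simp
  moreover have "0 < k" "0 < n - k" using k0 kn nontriv k by auto
  ultimately show thesis using that[OF nk _ _ AB_rep] by blast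
qed

text \<open>Strong induction on the degree: both parts of a splitting have smaller positive degree
  and are again unitary.\<close>

lemma unitary_rep_irreducible_decomposition:
  assumes "group \<Gamma>" and "unitary_rep \<Gamma> n R"
  shows "\<exists>\<sigma>s. irreducible_decomposition \<Gamma> R \<sigma>s"
  using assms(2)
proof (induction n arbitrary: R rule: less_induct)
  case (less n)
  have rep: "matrix_rep \<Gamma> n R" using less.prems by (simp add: unitary_rep_def)
  then have Rc: "R g \<in> carrier_mat n n" if "g \<in> carrier \<Gamma>" for g
    using that by (simp add: matrix_rep_def)
  consider "n = 0" | "irreducible_rep \<Gamma> n R" | "n > 0" "\<not> irreducible_rep \<Gamma> n R" by blast
  then show ?case
  proof cases
    case 1
    \<comment> \<open>Irreducibility demands positive degree, so degree 0 is served by the empty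
      list, whose block matrix is 0 by 0.\<close>
    have "R g = 0\<^sub>m 0 0" if "g \<in> carrier \<Gamma>" for g using Rc[OF that] 1 by auto
    then have "irreducible_decomposition \<Gamma> R []"
      using rep_equiv_refl[OF rep] by (simp add: irreducible_decomposition_def rep_equiv_def)
    then show ?thesis by blast
  next
    case 2
    then have "irreducible_decomposition \<Gamma> R [R]"
      using rep_equiv_refl[OF rep] by (auto simp: irreducible_decomposition_def simp del: diag_block_mat.simps)
    then show ?thesis by blast
  next
    case 3
    then obtain W where W: "VectorSpace.subspace class_ring W (module_vec TYPE(complex) n)"
      and inv: "\<And>g w. g \<in> carrier \<Gamma> \<Longrightarrow> w \<in> W \<Longrightarrow> R g *\<^sub>v w \<in> W"
      and nontriv: "W \<noteq> {0\<^sub>v n}" "W \<noteq> carrier_vec n"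
      using rep unfolding irreducible_rep_def by blast
    obtain p q A B where pq: "n = p + q" "0 < p" "0 < q"
      and A: "unitary_rep \<Gamma> p A" and B: "unitary_rep \<Gamma> q B"
      and eqv: "rep_equiv \<Gamma> R (\<lambda>g. four_block_mat (A g) (0\<^sub>m p q) (0\<^sub>m q p) (B g))"
      using reducible_unitary_rep_splits[OF assms(1) less.prems subspace_imp_linear_subspace[OF W] inv nontriv]
      by blast
    obtain as where as: "irreducible_decomposition \<Gamma> A as" using less.IH[OF _ A] pq by auto
    obtain bs where bs: "irreducible_decomposition \<Gamma> B bs" using less.IH[OF _ B] pq by auto
    let ?D = "\<lambda>\<sigma>s g. diag_block_mat (map (\<lambda>\<sigma>. \<sigma> g) \<sigma>s)"
    have Ac: "A g \<in> carrier_mat p p" and Bc: "B g \<in> carrier_mat q q" if "g \<in> carrier \<Gamma>" for g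
      using A B that by (auto simp: unitary_rep_def matrix_rep_def)
    have eA: "rep_equiv \<Gamma> A (?D as)" and eB: "rep_equiv \<Gamma> B (?D bs)"
      using as bs by (simp_all add: irreducible_decomposition_def)
    have "rep_equiv \<Gamma> R (\<lambda>g. four_block_mat (?D as g) (0\<^sub>m p q) (0\<^sub>m q p) (?D bs g))"
      by (rule rep_equiv_trans[OF eqv rep_equiv_four_block[OF eA Ac eB Bc]])
    moreover have "four_block_mat (?D as g) (0\<^sub>m p q) (0\<^sub>m q p) (?D bs g) = ?D (as @ bs) g"
      if g: "g \<in> carrier \<Gamma>" for g
    proof -
      \<comment> \<open>Appending lists produces zero blocks of the actual sizes of the two parts;
        similarity to \<open>A g\<close> and \<open>B g\<close> identifies these sizes as p and
        q.\<close>
      have "?D as g \<in> carrier_mat p p" "?D bs g \<in> carrier_mat q q"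
        using eA eB similar_mat_witD2(5)[OF Ac[OF g]] similar_mat_witD2(5)[OF Bc[OF g]] g
        unfolding rep_equiv_def by blast+
      then show ?thesis by (simp add: diag_block_mat_append Let_def)
    qed
    ultimately have "rep_equiv \<Gamma> R (?D (as @ bs))" unfolding rep_equiv_def by simp
    then have "irreducible_decomposition \<Gamma> R (as @ bs)"
      using as bs unfolding irreducible_decomposition_def by auto
    then show ?thesis by blast
  qed
qed

section \<open>The matrix attached to a representation\<close>

lemma minus_four_block_diag:
  fixes A B :: "complex mat"
  assumes "A \<in> carrier_mat n n" "A' \<in> carrier_mat n n" "B \<in> carrier_mat m m" "B' \<in> carrier_mat m m"
  shows "four_block_mat A (0\<^sub>m n m) (0\<^sub>m m n) B - four_block_mat A' (0\<^sub>m n m) (0\<^sub>m m n) B'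
    = four_block_mat (A - A') (0\<^sub>m n m) (0\<^sub>m m n) (B - B')"
  using assms by (intro eq_matI) auto

lemma add_four_block_diag:
  fixes A B :: "complex mat"
  assumes "A \<in> carrier_mat n n" "A' \<in> carrier_mat n n" "B \<in> carrier_mat m m" "B' \<in> carrier_mat m m"
  shows "four_block_mat A (0\<^sub>m n m) (0\<^sub>m m n) B + four_block_mat A' (0\<^sub>m n m) (0\<^sub>m m n) B'
    = four_block_mat (A + A') (0\<^sub>m n m) (0\<^sub>m m n) (B + B')"
  using assms by (intro eq_matI) auto

lemma mat_sum_four_block_diag:
  assumes I: "finite I" and A: "\<And>i. i \<in> I \<Longrightarrow> A i \<in> carrier_mat n n"
    and B: "\<And>i. i \<in> I \<Longrightarrow> B i \<in> carrier_mat m m"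
  shows "mat_sum (n + m) (\<lambda>i. four_block_mat (A i) (0\<^sub>m n m) (0\<^sub>m m n) (B i)) I
    = four_block_mat (mat_sum n A I) (0\<^sub>m n m) (0\<^sub>m m n) (mat_sum m B I)"
  using assms
proof (induction I)
  case empty
  then show ?case
    using module_mat.finsum_empty[of n n A] module_mat.finsum_empty[of m m B]
      module_mat.finsum_empty[of "n + m" "n + m"] by (simp add: module_mat_simps)
next
  case (insert x I)
  have "mat_sum n A I \<in> carrier_mat n n" "mat_sum m B I \<in> carrier_mat m m"
    using insert.prems by (auto intro!: mat_sum_carrier)
  moreover have "mat_sum n A (insert x I) = A x + mat_sum n A I"
    "mat_sum m B (insert x I) = B x + mat_sum m B I"
    using insert by (auto intro!: mat_sum_insert)
  moreover have "mat_sum (n + m) (\<lambda>i. four_block_mat (A i) (0\<^sub>m n m) (0\<^sub>m m n) (B i)) (insert x I)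
      = four_block_mat (A x) (0\<^sub>m n m) (0\<^sub>m m n) (B x)
        + mat_sum (n + m) (\<lambda>i. four_block_mat (A i) (0\<^sub>m n m) (0\<^sub>m m n) (B i)) I"
    using insert by (intro mat_sum_insert four_block_carrier_mat) auto
  ultimately show ?case
    using insert by (simp add: add_four_block_diag)
qed

lemma mat_sum_cong:
  assumes "\<And>i. i \<in> I \<Longrightarrow> M i = N i" and "\<And>i. i \<in> I \<Longrightarrow> N i \<in> carrier_mat n n"
  shows "mat_sum n M I = mat_sum n N I"
  using assms by (intro module_mat.finsum_cong') (auto simp: module_mat_simps)

lemma conjugate_minus_add:
  fixes X Y Z P Q :: "complex mat"
  assumes X: "X \<in> carrier_mat n n" and Y: "Y \<in> carrier_mat n n" and Z: "Z \<in> carrier_mat n n"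
    and P: "P \<in> carrier_mat n n" and Q: "Q \<in> carrier_mat n n"
  shows "P * X * Q - P * Y * Q + P * Z * Q = P * (X - Y + Z) * Q"
proof -
  have XY: "X - Y \<in> carrier_mat n n" by (rule minus_carrier_mat[OF Y])
  have c: "P * X \<in> carrier_mat n n" "P * Y \<in> carrier_mat n n" "P * Z \<in> carrier_mat n n"
    using X Y Z P by auto
  have "P * (X - Y + Z) * Q = (P * X - P * Y + P * Z) * Q"
    by (simp only: mult_add_distrib_mat[OF P XY Z] mult_minus_distrib_mat[OF P X Y])
  also have "\<dots> = P * X * Q - P * Y * Q + P * Z * Q"
    using add_mult_distrib_mat[OF minus_carrier_mat[OF c(2), of "P * X"] c(3) Q]
    by (simp only: minus_mult_distrib_mat[OF c(1,2) Q])
  finally show ?thesis ..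
qed

text \<open>Holds the graph data fixed while the representation varies. In the application
  \<open>C\<close> is the carrier of \<Gamma>, \<open>A\<close> gives the voltage adjacency
  matrices, \<open>D\<close> is the scaled degree matrix and k is the number of vertices of
  G.\<close>

locale voltage_family =
  fixes C S :: "'g set" and A :: "'g \<Rightarrow> complex mat" and D :: "complex mat" and k :: nat
  assumes finite_C: "finite C" and S_sub: "S \<subseteq> C"
    and A_carrier: "\<And>g. g \<in> C \<Longrightarrow> A g \<in> carrier_mat k k" and D_carrier: "D \<in> carrier_mat k k"
begin

text \<open>The degree n is an argument because the sizes of the identity and of the sums cannot be
  read off the function \<open>R\<close>.\<close>

definition twisted :: "nat \<Rightarrow> ('g \<Rightarrow> complex mat) \<Rightarrow> complex mat" where
  "twisted n R = mat_sum (n * k) (\<lambda>g. kronecker (R g) (A g)) C - kronecker (1\<^sub>m n) D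
     + kronecker (mat_sum n R S) (1\<^sub>m k)"

lemma summand_carriers:
  assumes "\<And>g. g \<in> C \<Longrightarrow> R g \<in> carrier_mat n n"
  shows "mat_sum (n * k) (\<lambda>g. kronecker (R g) (A g)) C \<in> carrier_mat (n * k) (n * k)"
    and "kronecker (1\<^sub>m n) D \<in> carrier_mat (n * k) (n * k)"
    and "mat_sum n R S \<in> carrier_mat n n"
    and "kronecker (mat_sum n R S) (1\<^sub>m k) \<in> carrier_mat (n * k) (n * k)"
proof -
  show "mat_sum (n * k) (\<lambda>g. kronecker (R g) (A g)) C \<in> carrier_mat (n * k) (n * k)"
    by (intro mat_sum_carrier kronecker_carrier assms A_carrier)
  show "kronecker (1\<^sub>m n) D \<in> carrier_mat (n * k) (n * k)"
    by (intro kronecker_carrier D_carrier) auto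
  show S: "mat_sum n R S \<in> carrier_mat n n"
    using S_sub assms by (intro mat_sum_carrier) auto
  show "kronecker (mat_sum n R S) (1\<^sub>m k) \<in> carrier_mat (n * k) (n * k)"
    by (intro kronecker_carrier S) auto
qed

lemma twisted_carrier:
  assumes "\<And>g. g \<in> C \<Longrightarrow> R g \<in> carrier_mat n n"
  shows "twisted n R \<in> carrier_mat (n * k) (n * k)"
  using summand_carriers[OF assms] by (auto simp: twisted_def)

text \<open>Conjugation by P \<otimes> I acts on the left Kronecker factors only. It carries
  \<open>R'\<close> to \<open>R\<close> in both sums and fixes the middle term, because
  \<open>P * Q\<close> is the identity.\<close>

lemma twisted_similar:
  assumes R: "\<And>g. g \<in> C \<Longrightarrow> R g \<in> carrier_mat n n" and ne: "C \<noteq> {}"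
    and wit: "\<And>g. g \<in> C \<Longrightarrow> similar_mat_wit (R g) (R' g) P Q"
  shows "similar_mat (twisted n R) (twisted n R')"
proof -
  note w = similar_mat_witD2[OF R wit]
  have R': "R' g \<in> carrier_mat n n" and eq: "R g = P * R' g * Q" if "g \<in> C" for g
    using w[OF that that] by auto
  \<comment> \<open>A single element suffices to learn that \<open>P\<close> and \<open>Q\<close>
    are n by n and mutually inverse, as the witnesses are shared by all of \<open>C\<close>.\<close>
  obtain g0 where "g0 \<in> C" using ne by blast
  from w[OF this this] have P: "P \<in> carrier_mat n n" and Q: "Q \<in> carrier_mat n n"
    and PQ: "P * Q = 1\<^sub>m n" and QP: "Q * P = 1\<^sub>m n" by auto
  let ?I = "1\<^sub>m k :: complex mat"
  let ?P = "kronecker P ?I" and ?Q = "kronecker Q ?I"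
  have Pc: "?P \<in> carrier_mat (n * k) (n * k)" and Qc: "?Q \<in> carrier_mat (n * k) (n * k)"
    using P Q by (auto intro: kronecker_carrier)
  have conj: "?P * kronecker X Y * ?Q = kronecker (P * X * Q) Y"
    if X: "X \<in> carrier_mat n n" and Y: "Y \<in> carrier_mat k k" for X Y
  proof -
    have "?P * kronecker X Y = kronecker (P * X) Y"
      using kronecker_mult[OF P X one_carrier_mat Y] Y by simp
    moreover have "kronecker (P * X) Y * ?Q = kronecker (P * X * Q) Y"
      using kronecker_mult[OF mult_carrier_mat[OF P X] Q Y one_carrier_mat] Y by simp
    ultimately show ?thesis by simp
  qed
  note c' = summand_carriers[of R' n, OF R']
  have S: "finite S" using finite_C S_sub finite_subset by blast
  have RC: "mat_sum (n * k) (\<lambda>g. kronecker (R g) (A g)) C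
      = ?P * mat_sum (n * k) (\<lambda>g. kronecker (R' g) (A g)) C * ?Q"
  proof -
    have "mat_sum (n * k) (\<lambda>g. kronecker (R g) (A g)) C
        = mat_sum (n * k) (\<lambda>g. ?P * kronecker (R' g) (A g) * ?Q) C"
    proof (rule mat_sum_cong)
      fix g assume g: "g \<in> C"
      show "kronecker (R g) (A g) = ?P * kronecker (R' g) (A g) * ?Q"
        using g by (simp add: conj[OF R' A_carrier] eq)
      show "?P * kronecker (R' g) (A g) * ?Q \<in> carrier_mat (n * k) (n * k)"
        using Pc Qc kronecker_carrier[OF R'[OF g] A_carrier[OF g]] by auto
    qed
    also have "\<dots> = ?P * mat_sum (n * k) (\<lambda>g. kronecker (R' g) (A g)) C * ?Q"
      by (intro mat_sum_conjugate finite_C Pc Qc kronecker_carrier R' A_carrier)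
    finally show ?thesis .
  qed
  have RS: "mat_sum n R S = P * mat_sum n R' S * Q"
  proof -
    have "mat_sum n R S = mat_sum n (\<lambda>g. P * R' g * Q) S"
      using P Q R' S_sub eq by (intro mat_sum_cong) (auto intro!: mult_carrier_mat[of _ _ n])
    also have "\<dots> = P * mat_sum n R' S * Q"
      using P Q R' S_sub S by (intro mat_sum_conjugate) auto
    finally show ?thesis .
  qed
  have "twisted n R = ?P * twisted n R' * ?Q"
  proof -
    have "kronecker (1\<^sub>m n) D = ?P * kronecker (1\<^sub>m n) D * ?Q"
      using conj[OF one_carrier_mat D_carrier] P PQ by simp
    moreover have "kronecker (mat_sum n R S) ?I = ?P * kronecker (mat_sum n R' S) ?I * ?Q"
      using conj[OF c'(3) one_carrier_mat] by (simp add: RS)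
    ultimately have "twisted n R = ?P * mat_sum (n * k) (\<lambda>g. kronecker (R' g) (A g)) C * ?Q
        - ?P * kronecker (1\<^sub>m n) D * ?Q + ?P * kronecker (mat_sum n R' S) ?I * ?Q"
      unfolding twisted_def RC by simp
    also have "\<dots> = ?P * twisted n R' * ?Q"
      unfolding twisted_def by (rule conjugate_minus_add[OF c'(1,2,4) Pc Qc])
    finally show ?thesis .
  qed
  moreover have "?P * ?Q = 1\<^sub>m (n * k)" "?Q * ?P = 1\<^sub>m (n * k)"
    using kronecker_mult[OF P Q one_carrier_mat one_carrier_mat, of k]
      kronecker_mult[OF Q P one_carrier_mat one_carrier_mat, of k] PQ QP
    by (simp_all add: kronecker_one_one)
  ultimately have "similar_mat_wit (twisted n R) (twisted n R') ?P ?Q"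
    using Pc Qc twisted_carrier[OF R] twisted_carrier[OF R'] by (intro similar_mat_witI) auto
  then show ?thesis unfolding similar_mat_def by blast
qed

text \<open>All three terms respect direct sums in the left factor: a boundary at n in the
  representation becomes a boundary at n * k.\<close>

lemma twisted_four_block:
  assumes X: "\<And>g. g \<in> C \<Longrightarrow> X g \<in> carrier_mat n n" and Y: "\<And>g. g \<in> C \<Longrightarrow> Y g \<in> carrier_mat m m"
  shows "twisted (n + m) (\<lambda>g. four_block_mat (X g) (0\<^sub>m n m) (0\<^sub>m m n) (Y g))
    = four_block_mat (twisted n X) (0\<^sub>m (n * k) (m * k)) (0\<^sub>m (m * k) (n * k)) (twisted m Y)"
proof -
  note c = summand_carriers[of X n, OF X] summand_carriers[of Y m, OF Y]
  let ?F = "\<lambda>M N. four_block_mat M (0\<^sub>m (n * k) (m * k)) (0\<^sub>m (m * k) (n * k)) N"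
  have S: "finite S" using finite_C S_sub finite_subset by blast
  have "mat_sum ((n + m) * k) (\<lambda>g. kronecker (four_block_mat (X g) (0\<^sub>m n m) (0\<^sub>m m n) (Y g)) (A g)) C
      = mat_sum (n * k + m * k) (\<lambda>g. ?F (kronecker (X g) (A g)) (kronecker (Y g) (A g))) C"
    unfolding add_mult_distrib
    by (intro mat_sum_cong kronecker_four_block_left four_block_carrier_mat kronecker_carrier X Y A_carrier)
  also have "\<dots> = ?F (mat_sum (n * k) (\<lambda>g. kronecker (X g) (A g)) C) (mat_sum (m * k) (\<lambda>g. kronecker (Y g) (A g)) C)"
    by (intro mat_sum_four_block_diag finite_C kronecker_carrier X Y A_carrier)
  finally have 1: "mat_sum ((n + m) * k) (\<lambda>g. kronecker (four_block_mat (X g) (0\<^sub>m n m) (0\<^sub>m m n) (Y g)) (A g)) C = \<dots>" .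
  have 2: "kronecker (1\<^sub>m (n + m)) D = ?F (kronecker (1\<^sub>m n) D) (kronecker (1\<^sub>m m) D)"
    using kronecker_four_block_left[OF one_carrier_mat one_carrier_mat D_carrier, of n m] by simp
  have "mat_sum (n + m) (\<lambda>g. four_block_mat (X g) (0\<^sub>m n m) (0\<^sub>m m n) (Y g)) S
      = four_block_mat (mat_sum n X S) (0\<^sub>m n m) (0\<^sub>m m n) (mat_sum m Y S)"
    using S S_sub X Y by (intro mat_sum_four_block_diag) auto
  then have 3: "kronecker (mat_sum (n + m) (\<lambda>g. four_block_mat (X g) (0\<^sub>m n m) (0\<^sub>m m n) (Y g)) S) (1\<^sub>m k)
      = ?F (kronecker (mat_sum n X S) (1\<^sub>m k)) (kronecker (mat_sum m Y S) (1\<^sub>m k))"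
    using kronecker_four_block_left[OF c(3,7) one_carrier_mat] by simp
  show ?thesis unfolding twisted_def 1 2 3
    using c by (simp add: minus_four_block_diag add_four_block_diag minus_carrier_mat)
qed

text \<open>Iterates the two-block case along the list; \<open>d\<close> records the degrees, since
  the summands are bare functions.\<close>

lemma twisted_diag_block:
  assumes "\<And>\<sigma> g. \<sigma> \<in> set \<sigma>s \<Longrightarrow> g \<in> C \<Longrightarrow> \<sigma> g \<in> carrier_mat (d \<sigma>) (d \<sigma>)"
  shows "twisted (sum_list (map d \<sigma>s)) (\<lambda>g. diag_block_mat (map (\<lambda>\<sigma>. \<sigma> g) \<sigma>s))
    = diag_block_mat (map (\<lambda>\<sigma>. twisted (d \<sigma>) \<sigma>) \<sigma>s)"
  using assms
proof (induction \<sigma>s)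
  case Nil
  have "twisted 0 (\<lambda>g. 0\<^sub>m 0 0) \<in> carrier_mat 0 0" using twisted_carrier[of "\<lambda>g. 0\<^sub>m 0 0" 0] by auto
  then show ?case by auto
next
  case (Cons \<sigma> \<sigma>s)
  let ?N = "sum_list (map d \<sigma>s)"
  let ?R = "\<lambda>g. diag_block_mat (map (\<lambda>\<sigma>. \<sigma> g) \<sigma>s)"
  have \<sigma>: "\<sigma> g \<in> carrier_mat (d \<sigma>) (d \<sigma>)" if "g \<in> C" for g using Cons.prems that by simp
  have R: "?R g \<in> carrier_mat ?N ?N" if "g \<in> C" for g
  proof -
    have "map dim_row (map (\<lambda>\<sigma>. \<sigma> g) \<sigma>s) = map d \<sigma>s" "map dim_col (map (\<lambda>\<sigma>. \<sigma> g) \<sigma>s) = map d \<sigma>s"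
      using Cons.prems that by auto
    then show ?thesis by (intro carrier_matI) (simp_all only: dim_diag_block_mat)
  qed
  have "twisted (sum_list (map d (\<sigma> # \<sigma>s))) (\<lambda>g. diag_block_mat (map (\<lambda>\<sigma>. \<sigma> g) (\<sigma> # \<sigma>s)))
      = twisted (d \<sigma> + ?N) (\<lambda>g. four_block_mat (\<sigma> g) (0\<^sub>m (d \<sigma>) ?N) (0\<^sub>m ?N (d \<sigma>)) (?R g))"
  proof -
    \<comment> \<open>The two families are known to agree on \<open>C\<close> only, so each sum is
      rewritten by congruence over its index set instead of equating the functions.\<close>
    have eq: "diag_block_mat (map (\<lambda>\<sigma>. \<sigma> g) (\<sigma> # \<sigma>s)) = four_block_mat (\<sigma> g) (0\<^sub>m (d \<sigma>) ?N) (0\<^sub>m ?N (d \<sigma>)) (?R g)"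
      if "g \<in> C" for g using \<sigma>[OF that] R[OF that] by (simp add: Let_def)
    have "mat_sum ((d \<sigma> + ?N) * k) (\<lambda>g. kronecker (diag_block_mat (map (\<lambda>\<sigma>. \<sigma> g) (\<sigma> # \<sigma>s))) (A g)) C
      = mat_sum ((d \<sigma> + ?N) * k) (\<lambda>g. kronecker (four_block_mat (\<sigma> g) (0\<^sub>m (d \<sigma>) ?N) (0\<^sub>m ?N (d \<sigma>)) (?R g)) (A g)) C"
      by (intro mat_sum_cong kronecker_carrier four_block_carrier_mat \<sigma> R A_carrier) (simp only: eq)
    moreover have "mat_sum (d \<sigma> + ?N) (\<lambda>g. diag_block_mat (map (\<lambda>\<sigma>. \<sigma> g) (\<sigma> # \<sigma>s))) S
      = mat_sum (d \<sigma> + ?N) (\<lambda>g. four_block_mat (\<sigma> g) (0\<^sub>m (d \<sigma>) ?N) (0\<^sub>m ?N (d \<sigma>)) (?R g)) S"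
      by (intro mat_sum_cong eq four_block_carrier_mat \<sigma> R) (use S_sub in auto)
    ultimately show ?thesis unfolding twisted_def by (simp only: list.map sum_list.Cons)
  qed
  also have "\<dots> = four_block_mat (twisted (d \<sigma>) \<sigma>) (0\<^sub>m (d \<sigma> * k) (?N * k)) (0\<^sub>m (?N * k) (d \<sigma> * k)) (twisted ?N ?R)"
    by (rule twisted_four_block[OF \<sigma> R])
  also have "\<dots> = diag_block_mat (map (\<lambda>\<sigma>. twisted (d \<sigma>) \<sigma>) (\<sigma> # \<sigma>s))"
    using twisted_carrier[of \<sigma> "d \<sigma>", OF \<sigma>] twisted_carrier[of ?R ?N, OF R] Cons by (simp add: Let_def)
  finally show ?case .
qed

end

section \<open>Permutation matrices and degrees in the bundle\<close>

text \<open>Passing from positions to vertices lets sums against an indicator of a vertex collapse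
  to one term.\<close>

lemma sum_nth_eq_sum_set:
  assumes "distinct xs"
  shows "(\<Sum>i<length xs. g (xs ! i)) = sum g (set xs)"
  using sum.reindex_bij_betw[OF bij_betw_nth[OF assms refl refl], of g] .

text \<open>The witness \<open>c xs ys\<close> is the permutation matrix relating the two lists.
  Stated for an arbitrary kernel h, so that adjacency and degrees are reordered together.\<close>

lemma enumeration_change_similar:
  fixes h :: "'a \<Rightarrow> 'a \<Rightarrow> complex"
  assumes xs: "distinct xs" and ys: "distinct ys" and eq: "set xs = set ys"
  shows "similar_mat (mat (length xs) (length xs) (\<lambda>(i, j). h (xs ! i) (xs ! j)))
    (mat (length ys) (length ys) (\<lambda>(i, j). h (ys ! i) (ys ! j)))"
proof -
  define n where "n = length xs"
  have len: "length xs = n" "length ys = n"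
    using distinct_card[OF xs] distinct_card[OF ys] eq by (simp_all add: n_def)
  define c :: "'a list \<Rightarrow> 'a list \<Rightarrow> complex mat" where
    "c as bs = mat n n (\<lambda>(i, j). if as ! i = bs ! j then 1 else 0)" for as bs
  have c: "c as bs \<in> carrier_mat n n" for as bs by (simp add: c_def)
  have inv: "c as bs * c bs as = 1\<^sub>m n"
    if as: "distinct as" "length as = n" and bs: "distinct bs" "length bs = n" and "set as = set bs" for as bs
  proof (rule eq_matI)
    fix i j assume "i < dim_row (1\<^sub>m n :: complex mat)" "j < dim_col (1\<^sub>m n :: complex mat)"
    then have ij: "i < n" "j < n" by auto
    have "(c as bs * c bs as) $$ (i, j)
        = (\<Sum>k<length bs. (if as ! i = bs ! k then 1 else 0) * (if bs ! k = as ! j then 1 else 0))"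
      using ij bs by (simp add: c_def scalar_prod_def lessThan_atLeast0)
    also have "\<dots> = (\<Sum>b\<in>set bs. (if as ! i = b then 1 else 0) * (if b = as ! j then 1 else 0))"
      by (rule sum_nth_eq_sum_set[OF bs(1)])
    also have "\<dots> = (\<Sum>b\<in>set bs. if as ! i = b then (if b = as ! j then 1 else 0) else 0)"
      by (intro sum.cong) auto
    also have "\<dots> = (if as ! i = as ! j then 1 else 0)"
      using nth_mem[of i as] ij as \<open>set as = set bs\<close> by (subst sum.delta') auto
    also have "\<dots> = 1\<^sub>m n $$ (i, j)" using ij as by (simp add: nth_eq_iff_index_eq)
    finally show "(c as bs * c bs as) $$ (i, j) = 1\<^sub>m n $$ (i, j)" .
  qed (auto simp: c_def)
  let ?M = "\<lambda>as. mat n n (\<lambda>(i, j). h (as ! i) (as ! j))"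
  \<comment> \<open>Both products have \<open>h (xs ! i) (ys ! j)\<close> at (i, j).\<close>
  have "?M xs * c xs ys = c xs ys * ?M ys"
  proof (rule eq_matI)
    fix i j assume "i < dim_row (c xs ys * ?M ys)" "j < dim_col (c xs ys * ?M ys)"
    then have ij: "i < n" "j < n" by (auto simp: c_def)
    have "(?M xs * c xs ys) $$ (i, j) = (\<Sum>k<length xs. h (xs ! i) (xs ! k) * (if xs ! k = ys ! j then 1 else 0))"
      using ij len by (simp add: c_def scalar_prod_def lessThan_atLeast0)
    also have "\<dots> = (\<Sum>x\<in>set xs. h (xs ! i) x * (if x = ys ! j then 1 else 0))"
      by (rule sum_nth_eq_sum_set[OF xs])
    also have "\<dots> = (\<Sum>x\<in>set xs. if x = ys ! j then h (xs ! i) x else 0)"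
      by (intro sum.cong) auto
    also have "\<dots> = h (xs ! i) (ys ! j)" using nth_mem[of j ys] ij len eq by (subst sum.delta) auto
    also have "\<dots> = (\<Sum>x\<in>set ys. if xs ! i = x then h x (ys ! j) else 0)"
      using nth_mem[of i xs] ij len eq by (subst sum.delta') auto
    also have "\<dots> = (\<Sum>x\<in>set ys. (if xs ! i = x then 1 else 0) * h x (ys ! j))"
      by (intro sum.cong) auto
    also have "\<dots> = (\<Sum>k<length ys. (if xs ! i = ys ! k then 1 else 0) * h (ys ! k) (ys ! j))"
      by (rule sum_nth_eq_sum_set[OF ys, symmetric])
    also have "\<dots> = (c xs ys * ?M ys) $$ (i, j)"
      using ij len by (simp add: c_def scalar_prod_def lessThan_atLeast0)
    finally show "(?M xs * c xs ys) $$ (i, j) = (c xs ys * ?M ys) $$ (i, j)" .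
  qed (auto simp: c_def)
  then have "c xs ys * ?M ys * c ys xs = ?M xs * (c xs ys * c ys xs)"
    using assoc_mult_mat[of "?M xs" n n "c xs ys" n "c ys xs" n] c by simp
  also have "\<dots> = ?M xs" using inv[OF xs len(1) ys len(2) eq] by simp
  finally have M: "?M xs = c xs ys * ?M ys * c ys xs" ..
  have "similar_mat_wit (?M xs) (?M ys) (c xs ys) (c ys xs)"
    by (rule similar_mat_witI[OF inv[OF xs len(1) ys len(2) eq]
      inv[OF ys len(2) xs len(1) eq[symmetric]] M]) (simp_all add: c)
  then show ?thesis unfolding similar_mat_def len by blast
qed

section \<open>The symmetric group and its permutation matrices\<close>

lemma group_perm_group: "group (perm_group V)"
proof (rule groupI)
  fix x assume "x \<in> carrier (perm_group V)"
  then have x: "x permutes V" by (simp add: perm_group_def)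
  \<comment> \<open>The left factor acts first, so a left inverse y of x has to satisfy
    \<open>x \<circ> y = id\<close>.\<close>
  then have "inv_into UNIV x permutes V" "x \<circ> inv_into UNIV x = id" by (auto intro: permutes_inv permutes_inv_o)
  then show "\<exists>y\<in>carrier (perm_group V). y \<otimes>\<^bsub>perm_group V\<^esub> x = \<one>\<^bsub>perm_group V\<^esub>"
    by (auto simp: perm_group_def)
qed (auto simp: perm_group_def permutes_compose permutes_id comp_assoc)

lemma perm_mat_carrier: "perm_mat vs g \<in> carrier_mat (length vs) (length vs)"
  by (simp add: perm_mat_def)

text \<open>The only intermediate vertex that contributes to row i is \<open>g (vs ! i)\<close>,
  which is again listed because g permutes the list.\<close>

lemma perm_mat_comp:
  assumes vs: "distinct vs" and g: "g permutes set vs"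
  shows "perm_mat vs (h \<circ> g) = perm_mat vs g * perm_mat vs h"
proof (rule eq_matI)
  let ?n = "length vs"
  fix i j assume "i < dim_row (perm_mat vs g * perm_mat vs h)" "j < dim_col (perm_mat vs g * perm_mat vs h)"
  then have ij: "i < ?n" "j < ?n" by (auto simp: perm_mat_def)
  have "(perm_mat vs g * perm_mat vs h) $$ (i, j)
      = (\<Sum>k<?n. (if g (vs ! i) = vs ! k then 1 else 0) * (if h (vs ! k) = vs ! j then 1 else 0))"
    using ij by (simp add: perm_mat_def scalar_prod_def lessThan_atLeast0)
  also have "\<dots> = (\<Sum>v\<in>set vs. (if g (vs ! i) = v then 1 else 0) * (if h v = vs ! j then 1 else 0))"
    by (rule sum_nth_eq_sum_set[OF vs])
  also have "\<dots> = (\<Sum>v\<in>set vs. if g (vs ! i) = v then (if h v = vs ! j then 1 else 0) else 0)"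
    by (intro sum.cong) auto
  also have "\<dots> = (if h (g (vs ! i)) = vs ! j then 1 else 0)"
    using permutes_in_image[OF g, of "vs ! i"] ij by (subst sum.delta') auto
  also have "\<dots> = perm_mat vs (h \<circ> g) $$ (i, j)" using ij by (simp add: perm_mat_def)
  finally show "perm_mat vs (h \<circ> g) $$ (i, j) = (perm_mat vs g * perm_mat vs h) $$ (i, j)" ..
qed (auto simp: perm_mat_def)

lemma perm_mat_id: "distinct vs \<Longrightarrow> perm_mat vs id = 1\<^sub>m (length vs)"
  by (rule eq_matI) (auto simp: perm_mat_def nth_eq_iff_index_eq)

lemma perm_mat_adjoint:
  assumes "g permutes set vs"
  shows "mat_adjoint (perm_mat vs g) = perm_mat vs (inv_into UNIV g)"
proof (rule eq_matI)
  note c = perm_mat_carrier[of vs g]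
  fix i j assume "i < dim_row (perm_mat vs (inv_into UNIV g))" "j < dim_col (perm_mat vs (inv_into UNIV g))"
  then have ij: "i < length vs" "j < length vs" by (auto simp: perm_mat_def)
  have "g (vs ! j) = vs ! i \<longleftrightarrow> inv_into UNIV g (vs ! i) = vs ! j"
    using permutes_inverses[OF assms] by metis
  then show "mat_adjoint (perm_mat vs g) $$ (i, j) = perm_mat vs (inv_into UNIV g) $$ (i, j)"
    using ij by (simp add: mat_adjoint_index[OF c]) (simp add: perm_mat_def)
qed (use mat_adjoint_carrier[OF perm_mat_carrier[of vs g]] in \<open>auto simp: perm_mat_def\<close>)

lemma unitary_rep_perm_mat:
  assumes vs: "distinct vs" and H: "H \<subseteq> carrier (perm_group (set vs))"
  shows "unitary_rep ((perm_group (set vs))\<lparr>carrier := H\<rparr>) (length vs) (perm_mat vs)"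
proof -
  have perm: "g permutes set vs" if "g \<in> H" for g using H that by (auto simp: perm_group_def)
  have "perm_mat vs g * mat_adjoint (perm_mat vs g) = 1\<^sub>m (length vs)" if "g \<in> H" for g
    using perm_mat_comp[OF vs perm[OF that], of "inv_into UNIV g"] perm_mat_id[OF vs]
      permutes_inv_o[OF perm[OF that]] by (simp add: perm_mat_adjoint[OF perm[OF that]])
  then show ?thesis
    using perm perm_mat_id[OF vs] perm_mat_comp[OF vs]
    by (simp add: unitary_rep_def matrix_rep_def perm_group_def perm_mat_carrier)
qed

text \<open>Compare row sums in A(F) = sum of P(s): on the left they count the neighbours of v, and
  each permutation matrix on the right has exactly one 1 in every row.\<close>

lemma schreier_graph_out_card:
  assumes F: "schreier_graph vs S F" and v: "v \<in> pverts F"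
  shows "card {w. (v, w) \<in> parcs F} = card S"
proof -
  have vs: "distinct vs" "set vs = pverts F" and S: "S \<subseteq> carrier (perm_group (pverts F))"
    and A: "adjacency_mat vs F = mat_sum (length vs) (perm_mat vs) S" and "pair_graph F"
    using F by (auto simp: schreier_graph_def)
  interpret pair_graph F by fact
  have finS: "finite S"
    using finite_subset[OF S] finite_permutations[of "pverts F"] vs(2) finite_set[of vs]
    by (simp add: perm_group_def)
  obtain i where i: "i < length vs" "vs ! i = v" using v vs by (metis in_set_conv_nth)
  have W: "{w. (v, w) \<in> parcs F} \<subseteq> set vs" using vs(2) in_arcsD2 by auto
  have "of_nat (card {w. (v, w) \<in> parcs F}) = (\<Sum>w\<in>set vs. if (v, w) \<in> parcs F then 1 else 0 :: complex)"
    using W by (simp add: sum.If_cases Int_absorb1 Int_commute)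
  also have "\<dots> = (\<Sum>j<length vs. adjacency_mat vs F $$ (i, j))"
    using i by (simp add: sum_nth_eq_sum_set[OF vs(1), symmetric] adjacency_mat_def)
  also have "\<dots> = (\<Sum>j<length vs. \<Sum>s\<in>S. if s v = vs ! j then 1 else 0)"
    unfolding A using i by (simp add: mat_sum_index[OF finS perm_mat_carrier]) (simp add: perm_mat_def)
  also have "\<dots> = (\<Sum>s\<in>S. \<Sum>j<length vs. if s v = vs ! j then 1 else 0)" by (rule sum.swap)
  also have "\<dots> = (\<Sum>s\<in>S. 1)"
  proof (rule sum.cong)
    fix s assume "s \<in> S"
    then have "s permutes pverts F" using S by (auto simp: perm_group_def)
    then have "s v \<in> set vs" using v vs(2) permutes_in_image by metis
    then show "(\<Sum>j<length vs. if s v = vs ! j then 1 else 0) = (1 :: complex)"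
      by (simp add: sum_nth_eq_sum_set[OF vs(1), of "\<lambda>w. if s v = w then 1 else 0"])
  qed simp
  also have "\<dots> = of_nat (card S)" by simp
  finally show ?thesis using of_nat_eq_iff by blast
qed

lemma out_degree_with_proj: "out_degree (with_proj X) x = card {y. (x, y) \<in> parcs X}"
proof -
  have "out_arcs (with_proj X) x = Pair x ` {y. (x, y) \<in> parcs X}" by (auto simp: out_arcs_def)
  then show ?thesis unfolding out_degree_def by (simp add: card_image inj_on_def)
qed

text \<open>The neighbours of (u, v) are one vertex over each neighbour of u and the neighbours of v
  in the fibre over u. The two kinds are disjoint because G has no loops.\<close>

lemma out_degree_graph_bundle:
  assumes G: "pair_graph G" and F: "schreier_graph vs S F" and \<phi>: "voltage_assignment G F \<phi>"
    and u: "u \<in> pverts G" and v: "v \<in> pverts F"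
  shows "out_degree (with_proj (graph_bundle G \<phi> F)) (u, v) = out_degree (with_proj G) u + card S"
proof -
  interpret G: pair_graph G by fact
  interpret F: pair_graph F using F by (simp add: schreier_graph_def)
  let ?X = "{w. (u, w) \<in> parcs G}" and ?Y = "{w. (v, w) \<in> parcs F}"
  have "\<phi> (u, w) v \<in> pverts F" if "(u, w) \<in> parcs G" for w
  proof -
    have "\<phi> (u, w) permutes pverts F" using \<phi> that by (auto simp: voltage_assignment_def graph_Aut_def)
    then show ?thesis using v permutes_in_image by metis
  qed
  then have "{y. ((u, v), y) \<in> parcs (graph_bundle G \<phi> F)} = (\<lambda>w. (w, \<phi> (u, w) v)) ` ?X \<union> Pair u ` ?Y"
    using u v G.in_arcsD2 F.in_arcsD2 by (auto simp: graph_bundle_def)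
  moreover have "card ((\<lambda>w. (w, \<phi> (u, w) v)) ` ?X \<union> Pair u ` ?Y) = card ?X + card ?Y"
  proof (subst card_Un_disjoint)
    have "?X \<subseteq> pverts G" "?Y \<subseteq> pverts F" using G.in_arcsD2 F.in_arcsD2 by auto
    then show "finite ((\<lambda>w. (w, \<phi> (u, w) v)) ` ?X)" "finite (Pair u ` ?Y)"
      using G.pair_finite_verts F.pair_finite_verts finite_subset by blast+
    show "(\<lambda>w. (w, \<phi> (u, w) v)) ` ?X \<inter> Pair u ` ?Y = {}" using G.pair_no_loops by fastforce
  qed (simp add: card_image inj_on_def)
  ultimately show ?thesis
    using schreier_graph_out_card[OF F v] by (simp add: out_degree_with_proj)
qed

text \<open>Sorts a multiset by the order of \<open>xs\<close>; the blocks of the decomposition are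
  collected by the index of their irreducible in this way.\<close>

lemma mset_replicate_count:
  assumes "distinct xs" and "set_mset M \<subseteq> set xs"
  shows "mset (concat (map (\<lambda>i. replicate (count M i) i) xs)) = M"
proof (rule multiset_eqI)
  fix x
  have "count (mset (concat (map (\<lambda>i. replicate (count M i) i) xs))) x = (if x \<in> set xs then count M x else 0)"
    using assms(1) by (induction xs) auto
  then show "count (mset (concat (map (\<lambda>i. replicate (count M i) i) xs))) x = count M x"
    using assms(2) by (auto simp: count_eq_zero_iff)
qed

lemma bundle_matrix_eq:
  assumes G: "pair_graph G" and us: "distinct us" "set us = pverts G"
    and F: "schreier_graph vs S F" and \<phi>: "voltage_assignment G F \<phi>"
    and C: "finite C" "\<phi> ` parcs G \<subseteq> C"
  shows "mat (length vs * length us) (length vs * length us) (\<lambda>(i, j).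
      (let x = (us ! (i mod length us), vs ! (i div length us));
           y = (us ! (j mod length us), vs ! (j div length us))
       in (if (x, y) \<in> parcs (graph_bundle G \<phi> F) then 1 else 0)
         - \<mu> * (if x = y then of_nat (out_degree (with_proj (graph_bundle G \<phi> F)) x) else 0)))
    = mat_sum (length vs * length us) (\<lambda>\<gamma>. kronecker (perm_mat vs \<gamma>) (voltage_adj_mat us G \<phi> \<gamma>)) C
      - kronecker (1\<^sub>m (length vs)) (\<mu> \<cdot>\<^sub>m (deg_mat us G + of_nat (card S) \<cdot>\<^sub>m 1\<^sub>m (length us)))
      + kronecker (mat_sum (length vs) (perm_mat vs) S) (1\<^sub>m (length us))"
    (is "?L = ?M1 - ?M2 + ?M3")
proof (rule eq_matI)
  interpret G: pair_graph G by fact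
  let ?n = "length vs" and ?k = "length us"
  let ?D = "\<mu> \<cdot>\<^sub>m (deg_mat us G + of_nat (card S) \<cdot>\<^sub>m 1\<^sub>m ?k)"
  have vs: "distinct vs" "set vs = pverts F"
    and adjF: "mat_sum ?n (perm_mat vs) S = adjacency_mat vs F"
    using F by (auto simp: schreier_graph_def)
  have Dc: "?D \<in> carrier_mat ?k ?k" by (auto simp: deg_mat_def)
  have Vc: "voltage_adj_mat us G \<phi> \<gamma> \<in> carrier_mat ?k ?k" for \<gamma> by (simp add: voltage_adj_mat_def)
  have Fc: "adjacency_mat vs F \<in> carrier_mat ?n ?n" by (simp add: adjacency_mat_def)
  have c1: "?M1 \<in> carrier_mat (?n * ?k) (?n * ?k)"
    by (intro mat_sum_carrier kronecker_carrier perm_mat_carrier Vc)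
  have c2: "?M2 \<in> carrier_mat (?n * ?k) (?n * ?k)" by (intro kronecker_carrier one_carrier_mat Dc)
  have c3: "?M3 \<in> carrier_mat (?n * ?k) (?n * ?k)"
    unfolding adjF by (intro kronecker_carrier one_carrier_mat Fc)
  show "dim_row ?L = dim_row (?M1 - ?M2 + ?M3)" "dim_col ?L = dim_col (?M1 - ?M2 + ?M3)" using c3 by auto
  fix i j assume "i < dim_row (?M1 - ?M2 + ?M3)" "j < dim_col (?M1 - ?M2 + ?M3)"
  then have i: "i < ?n * ?k" and j: "j < ?n * ?k" using c3 by auto
  \<comment> \<open>As in a Kronecker product, the quotient is the position in the fibre and the
    remainder the position in the base.\<close>
  define a b p q where "a = i mod ?k" and "b = j mod ?k" and "p = i div ?k" and "q = j div ?k"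
  have "?k \<noteq> 0" using i by (metis mult_0_right not_less_zero)
  then have ab: "a < ?k" "b < ?k" and pq: "p < ?n" "q < ?n"
    using i j by (auto simp: a_def b_def p_def q_def less_mult_imp_div_less)
  define u u' v v' where "u = us ! a" and "u' = us ! b" and "v = vs ! p" and "v' = vs ! q"
  have u: "u \<in> pverts G" "u' \<in> pverts G" and v: "v \<in> pverts F" "v' \<in> pverts F"
    using ab pq us vs unfolding u_def u'_def v_def v'_def by (metis nth_mem)+
  have eqs: "a = b \<longleftrightarrow> u = u'" "p = q \<longleftrightarrow> v = v'"
    using ab pq us(1) vs(1) by (auto simp: u_def u'_def v_def v'_def nth_eq_iff_index_eq)
  have 1: "?M1 $$ (i, j) = (if (u, u') \<in> parcs G \<and> \<phi> (u, u') v = v' then 1 else 0)"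
  proof -
    have "?M1 $$ (i, j) = (\<Sum>\<gamma>\<in>C. kronecker (perm_mat vs \<gamma>) (voltage_adj_mat us G \<phi> \<gamma>) $$ (i, j))"
      by (intro mat_sum_index C i j kronecker_carrier perm_mat_carrier Vc)
    \<comment> \<open>An arc has a single voltage, so one \<gamma> survives. It belongs to
      \<open>C\<close> if (u, u') is an arc; otherwise all terms are 0.\<close>
    also have "\<dots> = (\<Sum>\<gamma>\<in>C. if \<phi> (u, u') = \<gamma> then (if (u, u') \<in> parcs G \<and> \<gamma> v = v' then 1 else 0) else 0)"
    proof (rule sum.cong)
      fix \<gamma> assume "\<gamma> \<in> C"
      have "kronecker (perm_mat vs \<gamma>) (voltage_adj_mat us G \<phi> \<gamma>) $$ (i, j)
          = perm_mat vs \<gamma> $$ (p, q) * voltage_adj_mat us G \<phi> \<gamma> $$ (a, b)"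
        using kronecker_index[OF perm_mat_carrier Vc i j] by (simp add: a_def b_def p_def q_def)
      then show "kronecker (perm_mat vs \<gamma>) (voltage_adj_mat us G \<phi> \<gamma>) $$ (i, j)
          = (if \<phi> (u, u') = \<gamma> then (if (u, u') \<in> parcs G \<and> \<gamma> v = v' then 1 else 0) else 0)"
        using ab pq by (auto simp: perm_mat_def voltage_adj_mat_def u_def u'_def v_def v'_def)
    qed simp
    also have "\<dots> = (if (u, u') \<in> parcs G \<and> \<phi> (u, u') v = v' then 1 else 0)"
      using C by (subst sum.delta') auto
    finally show ?thesis .
  qed
  have 2: "?M2 $$ (i, j) = \<mu> * (if u = u' \<and> v = v' then of_nat (out_degree (with_proj G) u + card S) else 0)"
  proof -
    have "?M2 $$ (i, j) = 1\<^sub>m ?n $$ (p, q) * ?D $$ (a, b)"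
      using kronecker_index[OF one_carrier_mat Dc i j] by (simp add: a_def b_def p_def q_def)
    also have "\<dots> = \<mu> * (if u = u' \<and> v = v' then of_nat (out_degree (with_proj G) u + card S) else 0)"
      using ab pq by (auto simp: deg_mat_def eqs) (auto simp: u_def algebra_simps)
    finally show ?thesis .
  qed
  have 3: "?M3 $$ (i, j) = (if u = u' \<and> (v, v') \<in> parcs F then 1 else 0)"
  proof -
    have "?M3 $$ (i, j) = adjacency_mat vs F $$ (p, q) * 1\<^sub>m ?k $$ (a, b)"
      unfolding adjF using kronecker_index[OF Fc one_carrier_mat i j] by (simp add: a_def b_def p_def q_def)
    then show ?thesis using ab pq by (auto simp: adjacency_mat_def v_def v'_def eqs)
  qed
  have "?L $$ (i, j) = (if ((u, v), (u', v')) \<in> parcs (graph_bundle G \<phi> F) then 1 else 0)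
      - \<mu> * (if (u, v) = (u', v') then of_nat (out_degree (with_proj (graph_bundle G \<phi> F)) (u, v)) else 0)"
    using i j by (simp add: Let_def u_def u'_def v_def v'_def a_def b_def p_def q_def)
  also have "((u, v), (u', v')) \<in> parcs (graph_bundle G \<phi> F)
      \<longleftrightarrow> (u, u') \<in> parcs G \<and> \<phi> (u, u') v = v' \<or> u = u' \<and> (v, v') \<in> parcs F"
    using u v by (auto simp: graph_bundle_def)
  also have "out_degree (with_proj (graph_bundle G \<phi> F)) (u, v) = out_degree (with_proj G) u + card S"
    by (rule out_degree_graph_bundle[OF G F \<phi> u(1) v(1)])
  \<comment> \<open>Adjacency is a disjunction while the matrices are added; as G has no loops, the
    two alternatives never hold together and no entry becomes 2.\<close>
  also have "(if (u, u') \<in> parcs G \<and> \<phi> (u, u') v = v' \<or> u = u' \<and> (v, v') \<in> parcs F then 1 else 0)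
        - \<mu> * (if (u, v) = (u', v') then of_nat (out_degree (with_proj G) u + card S) else 0)
      = ?M1 $$ (i, j) - ?M2 $$ (i, j) + ?M3 $$ (i, j)"
    unfolding 1 2 3 using G.pair_no_loops[of "(u, u')"] by auto
  also have "\<dots> = (?M1 - ?M2 + ?M3) $$ (i, j)" using c1 c2 c3 i j by auto
  finally show "?L $$ (i, j) = (?M1 - ?M2 + ?M3) $$ (i, j)" .
qed

lemma adjacency_minus_deg_eq:
  assumes "distinct xs"
  shows "adjacency_mat xs X - \<mu> \<cdot>\<^sub>m deg_mat xs X = mat (length xs) (length xs) (\<lambda>(i, j).
    (\<lambda>x y. (if (x, y) \<in> parcs X then 1 else 0)
       - \<mu> * (if x = y then of_nat (out_degree (with_proj X) x) else 0)) (xs ! i) (xs ! j))"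
  by (rule eq_matI)
    (use assms in \<open>auto simp: adjacency_mat_def deg_mat_def nth_eq_iff_index_eq\<close>)

lemma bundle_matrix_similar:
  assumes G: "pair_graph G" and us: "distinct us" "set us = pverts G"
    and F: "schreier_graph vs S F" and \<phi>: "voltage_assignment G F \<phi>"
    and C: "finite C" "\<phi> ` parcs G \<subseteq> C"
    and ws: "distinct ws" "set ws = pverts (graph_bundle G \<phi> F)"
  shows "similar_mat (adjacency_mat ws (graph_bundle G \<phi> F) - \<mu> \<cdot>\<^sub>m deg_mat ws (graph_bundle G \<phi> F))
    (mat_sum (length vs * length us) (\<lambda>\<gamma>. kronecker (perm_mat vs \<gamma>) (voltage_adj_mat us G \<phi> \<gamma>)) C
      - kronecker (1\<^sub>m (length vs)) (\<mu> \<cdot>\<^sub>m (deg_mat us G + of_nat (card S) \<cdot>\<^sub>m 1\<^sub>m (length us)))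
      + kronecker (mat_sum (length vs) (perm_mat vs) S) (1\<^sub>m (length us)))"
proof -
  let ?X = "graph_bundle G \<phi> F"
  let ?h = "\<lambda>x y. (if (x, y) \<in> parcs ?X then 1 else 0)
    - \<mu> * (if x = y then of_nat (out_degree (with_proj ?X) x) else 0)"
  \<comment> \<open>In \<open>List.product vs us\<close> the fibre coordinate varies slowest; the
    swap turns its entries into vertices of the bundle.\<close>
  define zs where "zs = map prod.swap (List.product vs us)"
  have vs: "distinct vs" "set vs = pverts F" using F by (auto simp: schreier_graph_def)
  have zs: "distinct zs" "set zs = set ws"
    using vs us ws by (auto simp: zs_def distinct_map distinct_product graph_bundle_def)
  have len: "length zs = length vs * length us" by (simp add: zs_def)
  have nth: "zs ! i = (us ! (i mod length us), vs ! (i div length us))" if "i < length vs * length us" for i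
    using that by (simp add: zs_def product_nth)
  have "mat (length zs) (length zs) (\<lambda>(i, j). ?h (zs ! i) (zs ! j))
    = mat_sum (length vs * length us) (\<lambda>\<gamma>. kronecker (perm_mat vs \<gamma>) (voltage_adj_mat us G \<phi> \<gamma>)) C
      - kronecker (1\<^sub>m (length vs)) (\<mu> \<cdot>\<^sub>m (deg_mat us G + of_nat (card S) \<cdot>\<^sub>m 1\<^sub>m (length us)))
      + kronecker (mat_sum (length vs) (perm_mat vs) S) (1\<^sub>m (length us))"
    unfolding bundle_matrix_eq[OF G us F \<phi> C, symmetric] len
    by (rule cong_mat) (simp_all add: nth Let_def)
  then show ?thesis
    using enumeration_change_similar[OF ws(1) zs(1) zs(2)[symmetric], of ?h]
    by (simp only: adjacency_minus_deg_eq[OF ws(1)])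
qed

theorem theorem3p3:
  fixes G :: "'a pair_pre_digraph" and F :: "'b pair_pre_digraph"
    and us :: "'a list" and vs :: "'b list" and ws :: "('a \<times> 'b) list"
    and S :: "('b \<Rightarrow> 'b) set" and \<phi> :: "'a \<times> 'a \<Rightarrow> 'b \<Rightarrow> 'b"
    and \<Gamma> :: "('b \<Rightarrow> 'b) monoid"
    and l :: nat and f m :: "nat \<Rightarrow> nat" and \<rho> :: "nat \<Rightarrow> ('b \<Rightarrow> 'b) \<Rightarrow> complex mat"
    and \<mu> :: complex
  assumes "pair_graph G" and "Digraph_Component.connected (with_proj G)"
    and "distinct us" and "set us = pverts G"
    and "schreier_graph vs S F"
    and "voltage_assignment G F \<phi>"
    and "\<Gamma> = (perm_group (pverts F))
           \<lparr>carrier := generate (perm_group (pverts F)) (\<phi> ` parcs G \<union> S)\<rparr>"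
    and "complete_irreps \<Gamma> l f \<rho>"
    and "\<And>i. i \<in> {1..l} \<Longrightarrow> unitary_rep \<Gamma> (f i) (\<rho> i)"
    and "1 \<le> l" and "f 1 = 1" and "\<And>\<gamma>. \<gamma> \<in> carrier \<Gamma> \<Longrightarrow> \<rho> 1 \<gamma> = 1\<^sub>m 1"
    and "\<And>i. i \<in> {1..l} \<Longrightarrow> m i = rep_multiplicity \<Gamma> (\<rho> i) (perm_mat vs)"
    and "distinct ws" and "set ws = pverts (graph_bundle G \<phi> F)"
  shows "similar_mat
    (adjacency_mat ws (graph_bundle G \<phi> F) - \<mu> \<cdot>\<^sub>m deg_mat ws (graph_bundle G \<phi> F))
    (diag_block_mat (map (\<lambda>i.
       kronecker (1\<^sub>m (m i))
         (mat_sum (f i * length us)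
            (\<lambda>\<gamma>. kronecker (\<rho> i \<gamma>) (voltage_adj_mat us G \<phi> \<gamma>)) (carrier \<Gamma>)
          - kronecker (1\<^sub>m (f i))
              (\<mu> \<cdot>\<^sub>m (deg_mat us G + of_nat (card S) \<cdot>\<^sub>m 1\<^sub>m (length us)))
          + kronecker (mat_sum (f i) (\<rho> i) S) (1\<^sub>m (length us))))
       [1..<Suc l]))"
proof -
  note [trans] = similar_mat_trans
  note G = assms(1) and us = assms(3,4) and F = assms(5) and \<phi> = assms(6) and \<Gamma> = assms(7)
    and irreps = assms(8) and m = assms(13) and ws = assms(14,15)
  let ?V = "pverts F" and ?n = "length vs" and ?k = "length us"
  let ?D = "\<mu> \<cdot>\<^sub>m (deg_mat us G + of_nat (card S) \<cdot>\<^sub>m 1\<^sub>m ?k)"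
  have vs: "distinct vs" "set vs = ?V" and S: "S \<subseteq> carrier (perm_group ?V)"
    using F by (auto simp: schreier_graph_def)
  interpret P: group "perm_group ?V" by (rule group_perm_group)
  have gens: "\<phi> ` parcs G \<union> S \<subseteq> carrier (perm_group ?V)"
    using \<phi> S by (auto simp: voltage_assignment_def graph_Aut_def perm_group_def)
  have sub: "subgroup (carrier \<Gamma>) (perm_group ?V)"
    using P.generate_is_subgroup[OF gens] by (simp add: \<Gamma>)
  have grp: "group \<Gamma>" using P.subgroup_imp_group[OF P.generate_is_subgroup[OF gens]] by (simp add: \<Gamma>)
  have Csub: "carrier \<Gamma> \<subseteq> carrier (perm_group ?V)" by (rule subgroup.subset[OF sub])
  have finC: "finite (carrier \<Gamma>)"
    using finite_subset[OF Csub] finite_permutations[of ?V] finite_set[of vs] vs(2)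
    by (simp add: perm_group_def)
  have gensC: "\<phi> ` parcs G \<union> S \<subseteq> carrier \<Gamma>" by (simp add: \<Gamma> subset_iff generate.incl)
  have ne: "carrier \<Gamma> \<noteq> {}" using subgroup.one_closed[OF sub] by blast
  interpret voltage_family "carrier \<Gamma>" S "voltage_adj_mat us G \<phi>" ?D ?k
    by unfold_locales (use finC gensC in \<open>auto simp: voltage_adj_mat_def deg_mat_def\<close>)
  have "unitary_rep \<Gamma> ?n (perm_mat vs)"
    using unitary_rep_perm_mat[OF vs(1), of "carrier \<Gamma>"] Csub vs(2) by (simp add: \<Gamma>)
  then have ex: "\<exists>\<sigma>s. irreducible_decomposition \<Gamma> (perm_mat vs) \<sigma>s"
    by (rule unitary_rep_irreducible_decomposition[OF grp])
  \<comment> \<open>This is the very choice made inside \<open>rep_multiplicity\<close>, so each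
    \<open>m i\<close> counts members of this list.\<close>
  define \<sigma>s where "\<sigma>s = (SOME \<sigma>s. irreducible_decomposition \<Gamma> (perm_mat vs) \<sigma>s)"
  have dec: "irreducible_decomposition \<Gamma> (perm_mat vs) \<sigma>s"
    unfolding \<sigma>s_def by (rule someI_ex[OF ex])
  then obtain d where irr: "\<And>\<sigma>. \<sigma> \<in> set \<sigma>s \<Longrightarrow> irreducible_rep \<Gamma> (d \<sigma>) \<sigma>"
    unfolding irreducible_decomposition_def by metis
  have dc: "\<sigma> g \<in> carrier_mat (d \<sigma>) (d \<sigma>)" if "\<sigma> \<in> set \<sigma>s" "g \<in> carrier \<Gamma>" for \<sigma> g
    using irr[OF that(1)] that(2) by (simp add: irreducible_rep_def matrix_rep_def)
  note complete = irreps[unfolded complete_irreps_def, THEN conjunct2, THEN conjunct2, rule_format]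
    and inequivalent = irreps[unfolded complete_irreps_def, THEN conjunct2, THEN conjunct1, rule_format]
    and irreducible = irreps[unfolded complete_irreps_def, THEN conjunct1, rule_format]
  have "\<exists>i\<in>{1..l}. rep_equiv \<Gamma> \<sigma> (\<rho> i)" if "\<sigma> \<in> set \<sigma>s" for \<sigma>
    by (rule complete[OF irr[OF that]])
  then obtain t where t: "\<And>\<sigma>. \<sigma> \<in> set \<sigma>s \<Longrightarrow> t \<sigma> \<in> {1..l}"
    and t_eq: "\<And>\<sigma>. \<sigma> \<in> set \<sigma>s \<Longrightarrow> rep_equiv \<Gamma> \<sigma> (\<rho> (t \<sigma>))"
    by metis
  \<comment> \<open>Pairwise inequivalence makes \<open>t \<sigma>\<close> the only index whose
    irreducible is equivalent to \<sigma>.\<close>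
  have t_iff: "rep_equiv \<Gamma> (\<rho> i) \<sigma> \<longleftrightarrow> t \<sigma> = i" if "\<sigma> \<in> set \<sigma>s" "i \<in> {1..l}" for \<sigma> i
  proof
    assume "rep_equiv \<Gamma> (\<rho> i) \<sigma>"
    then have "rep_equiv \<Gamma> (\<rho> i) (\<rho> (t \<sigma>))" by (rule rep_equiv_trans[OF _ t_eq[OF that(1)]])
    then show "t \<sigma> = i" using inequivalent[OF that(2) t[OF that(1)]] by metis
  next
    assume "t \<sigma> = i"
    then show "rep_equiv \<Gamma> (\<rho> i) \<sigma>" using rep_equiv_sym[OF t_eq[OF that(1)]] by simp
  qed
  have \<rho>c: "\<rho> i g \<in> carrier_mat (f i) (f i)" if "i \<in> {1..l}" "g \<in> carrier \<Gamma>" for i g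
    using irreducible[OF that(1)] that(2) by (simp add: irreducible_rep_def matrix_rep_def)
  have m_count: "m i = count (mset (map t \<sigma>s)) i" if "i \<in> {1..l}" for i
  proof -
    have "filter (rep_equiv \<Gamma> (\<rho> i)) \<sigma>s = filter (\<lambda>\<sigma>. t \<sigma> = i) \<sigma>s"
      using t_iff[OF _ that] by (intro filter_cong) auto
    then have "m i = length (filter (\<lambda>\<sigma>. t \<sigma> = i) \<sigma>s)"
      unfolding m[OF that] rep_multiplicity_def \<sigma>s_def[symmetric] by simp
    also have "length (filter (\<lambda>\<sigma>. t \<sigma> = i) xs) = count (mset (map t xs)) i" for xs
      by (induction xs) auto
    finally show ?thesis .
  qed
  let ?X = "\<lambda>i. twisted (f i) (\<rho> i)"
  have Xc: "?X i \<in> carrier_mat (f i * ?k) (f i * ?k)" if "i \<in> {1..l}" for i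
    by (rule twisted_carrier[OF \<rho>c[OF that]])
  let ?R = "\<lambda>g. diag_block_mat (map (\<lambda>\<sigma>. \<sigma> g) \<sigma>s)"
  have "similar_mat (adjacency_mat ws (graph_bundle G \<phi> F) - \<mu> \<cdot>\<^sub>m deg_mat ws (graph_bundle G \<phi> F))
      (twisted ?n (perm_mat vs))"
    unfolding twisted_def using gensC by (intro bundle_matrix_similar G us F \<phi> finC ws) auto
  also have "similar_mat (twisted ?n (perm_mat vs)) (twisted ?n ?R)"
  proof -
    obtain T T' where "\<And>g. g \<in> carrier \<Gamma> \<Longrightarrow> similar_mat_wit (perm_mat vs g) (?R g) T T'"
      using dec unfolding irreducible_decomposition_def rep_equiv_def by blast
    then show ?thesis by (rule twisted_similar[OF perm_mat_carrier ne])
  qed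
  also have "twisted ?n ?R = diag_block_mat (map (\<lambda>\<sigma>. twisted (d \<sigma>) \<sigma>) \<sigma>s)"
  proof -
    \<comment> \<open>The degrees of the summands add up to the number of vertices of F; comparing
      dimensions at one group element shows it.\<close>
    obtain g where g: "g \<in> carrier \<Gamma>" using ne by blast
    then have "?R g \<in> carrier_mat ?n ?n"
      using dec similar_mat_witD2(5)[OF perm_mat_carrier]
      unfolding irreducible_decomposition_def rep_equiv_def by blast
    moreover have "map dim_row (map (\<lambda>\<sigma>. \<sigma> g) \<sigma>s) = map d \<sigma>s" using dc g by auto
    ultimately have "?n = sum_list (map d \<sigma>s)" by (metis carrier_matD(1) dim_diag_block_mat(1))
    then show ?thesis using twisted_diag_block[of \<sigma>s d, OF dc] by simp
  qed
  also have "similar_mat \<dots> (diag_block_mat (map (\<lambda>\<sigma>. ?X (t \<sigma>)) \<sigma>s))"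
  proof -
    have "similar_mat (twisted (d \<sigma>) \<sigma>) (?X (t \<sigma>))" if \<sigma>: "\<sigma> \<in> set \<sigma>s" for \<sigma>
    proof -
      obtain T T' where wit: "\<And>g. g \<in> carrier \<Gamma> \<Longrightarrow> similar_mat_wit (\<sigma> g) (\<rho> (t \<sigma>) g) T T'"
        using t_eq[OF \<sigma>] unfolding rep_equiv_def by blast
      obtain g where g: "g \<in> carrier \<Gamma>" using ne by blast
      have "\<rho> (t \<sigma>) g \<in> carrier_mat (d \<sigma>) (d \<sigma>)"
        by (rule similar_mat_witD2(5)[OF dc[OF \<sigma> g] wit[OF g]])
      \<comment> \<open>Equivalent representations have equal degree, so both sides are instances of
        \<open>twisted\<close> with the same n.\<close>
      then have "f (t \<sigma>) = d \<sigma>" using \<rho>c[OF t[OF \<sigma>] g] by auto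
      then show ?thesis using twisted_similar[OF dc[OF \<sigma>] ne wit] by simp
    qed
    then show ?thesis
      using similar_diag_mat_block_mat[of "map (\<lambda>\<sigma>. (twisted (d \<sigma>) \<sigma>, ?X (t \<sigma>))) \<sigma>s"]
      by (auto simp: comp_def)
  qed
  \<comment> \<open>The blocks now depend on \<sigma> only through \<open>t \<sigma>\<close>, so it
    suffices to compare multisets of indices, where i occurs \<open>m i\<close> times.\<close>
  also have "similar_mat \<dots> (diag_block_mat (concat (map (\<lambda>i. replicate (m i) (?X i)) [1..<Suc l])))"
  proof (rule diag_block_mat_perm_similar)
    have "concat (map (\<lambda>i. replicate (m i) (?X i)) [1..<Suc l])
        = map ?X (concat (map (\<lambda>i. replicate (count (mset (map t \<sigma>s)) i) i) [1..<Suc l]))"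
      unfolding map_concat map_map comp_def map_replicate
      by (intro arg_cong[of _ _ concat] map_cong refl arg_cong2[of _ _ _ _ replicate] m_count) auto
    moreover have "mset (concat (map (\<lambda>i. replicate (count (mset (map t \<sigma>s)) i) i) [1..<Suc l])) = mset (map t \<sigma>s)"
      using t by (intro mset_replicate_count) fastforce+
    ultimately show "mset (map (\<lambda>\<sigma>. ?X (t \<sigma>)) \<sigma>s) = mset (concat (map (\<lambda>i. replicate (m i) (?X i)) [1..<Suc l]))"
      by (metis (no_types, lifting) list.map_comp comp_apply map_eq_conv mset_map)
    show "square_mat M" if "M \<in> set (map (\<lambda>\<sigma>. ?X (t \<sigma>)) \<sigma>s)" for M using that Xc t by fastforce
  qed
  also have "diag_block_mat (concat (map (\<lambda>i. replicate (m i) (?X i)) [1..<Suc l]))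
      = diag_block_mat (map (\<lambda>i. kronecker (1\<^sub>m (m i)) (?X i)) [1..<Suc l])"
    unfolding diag_block_mat_concat map_map comp_def
    by (intro arg_cong[of _ _ diag_block_mat] map_cong refl
      kronecker_one_eq_diag_block_replicate[OF Xc, symmetric]) auto
  finally show ?thesis unfolding twisted_def .
qed

end
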